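(* Let $k$ be a field and let $G$ be a $\frac{3}{2}$-transitive permutation group on a finite set $\Omega$. Then the endomorphism ring $\operatorname{End}_{kG}(k\Omega)$ of the natural permutation module $k\Omega$ for $kG$ is a symmetric algebra.
   Context: All groups and sets are finite and modules are right modules. A permutation group $G\leq \mathrm{Sym}(\Omega)$ is $\frac{3}{2}$-transitive if it is transitive on $\Omega$, is not regular, and for a point $\alpha\in\Omega$ all the nontrivial orbits of the point stabilizer $G_\alpha$ (that is, all orbits of $G_\alpha$ on $\Omega\setminus\{\alpha\}$) have equal size. For a permutation group $G$ on $\Omega$, $k\Omega$ denotes the $k$-vector space with basis $\Omega$, regarded as a $kG$-module via $(\sum_{\alpha\in\Omega}a_\alpha\alpha)\cdot g=\sum_{\alpha\in\Omega}a_\alpha(\alpha\cdot g)$ for $g\in G$. A (finite-dimensional) $k$-algebra $A$ is symmetric if $\operatorname{Hom}_k(A,k)\cong A$ as $A$-$A$-bimodules, equivalently, if there is a non-degenerate symmetric associative $k$-bilinear form $f:A\times A\to k$ (associative meaning $f(ab,c)=f(a,bc)$). *)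

theory Defs
  imports "HOL-Algebra.Module" "HOL-Algebra.Group_Action"
begin

section \<open>Symmetric algebras\<close>

text \<open>The locale \<^locale>\<open>algebra\<close> of the library demands a commutative product, hence
  a locale of our own.\<close>

locale fin_dim_algebra = K?: field K + module K A + A?: ring A
  for K (structure) and A (structure) +
  assumes smult_mult_left:
      "\<lbrakk> c \<in> carrier K; x \<in> carrier A; y \<in> carrier A \<rbrakk>
        \<Longrightarrow> (c \<odot>\<^bsub>A\<^esub> x) \<otimes>\<^bsub>A\<^esub> y = c \<odot>\<^bsub>A\<^esub> (x \<otimes>\<^bsub>A\<^esub> y)"
    and smult_mult_right:
      "\<lbrakk> c \<in> carrier K; x \<in> carrier A; y \<in> carrier A \<rbrakk>
        \<Longrightarrow> x \<otimes>\<^bsub>A\<^esub> (c \<odot>\<^bsub>A\<^esub> y) = c \<odot>\<^bsub>A\<^esub> (x \<otimes>\<^bsub>A\<^esub> y)"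
    and finite_spanning_set:
      "\<exists>B. finite B \<and> B \<subseteq> carrier A \<and>
         (\<forall>x \<in> carrier A. \<exists>c \<in> B \<rightarrow> carrier K. x = (\<Oplus>\<^bsub>A\<^esub>b\<in>B. c b \<odot>\<^bsub>A\<^esub> b))"

definition dual_space :: "('k, 'm) ring_scheme \<Rightarrow> ('k, 'a, 'n) module_scheme \<Rightarrow> ('a \<Rightarrow> 'k) set"
  where "dual_space K A =
    {\<phi> \<in> carrier A \<rightarrow>\<^sub>E carrier K.
       (\<forall>x \<in> carrier A. \<forall>y \<in> carrier A. \<phi> (x \<oplus>\<^bsub>A\<^esub> y) = \<phi> x \<oplus>\<^bsub>K\<^esub> \<phi> y) \<and>
       (\<forall>c \<in> carrier K. \<forall>x \<in> carrier A. \<phi> (c \<odot>\<^bsub>A\<^esub> x) = c \<otimes>\<^bsub>K\<^esub> \<phi> x)}"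

text \<open>Isomorphisms of bimodules from \<open>A\<close> to \<open>Hom\<^sub>K(A, K)\<close>. The bimodule structure on the
  dual is \<open>(a \<cdot> \<phi> \<cdot> b)(x) = \<phi>(b x a)\<close>; the last two conditions say that
  \<open>\<theta>(a z) = a \<cdot> \<theta>(z)\<close> and \<open>\<theta>(z b) = \<theta>(z) \<cdot> b\<close>.\<close>

definition dual_bimodule_iso ::
    "('k, 'm) ring_scheme \<Rightarrow> ('k, 'a, 'n) module_scheme \<Rightarrow> ('a \<Rightarrow> 'a \<Rightarrow> 'k) \<Rightarrow> bool"
  where "dual_bimodule_iso K A \<theta> \<longleftrightarrow>
    bij_betw \<theta> (carrier A) (dual_space K A) \<and>
    (\<forall>y \<in> carrier A. \<forall>z \<in> carrier A. \<theta> (y \<oplus>\<^bsub>A\<^esub> z) = (\<lambda>x \<in> carrier A. \<theta> y x \<oplus>\<^bsub>K\<^esub> \<theta> z x)) \<and>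
    (\<forall>c \<in> carrier K. \<forall>z \<in> carrier A. \<theta> (c \<odot>\<^bsub>A\<^esub> z) = (\<lambda>x \<in> carrier A. c \<otimes>\<^bsub>K\<^esub> \<theta> z x)) \<and>
    (\<forall>a \<in> carrier A. \<forall>z \<in> carrier A. \<theta> (a \<otimes>\<^bsub>A\<^esub> z) = (\<lambda>x \<in> carrier A. \<theta> z (x \<otimes>\<^bsub>A\<^esub> a))) \<and>
    (\<forall>b \<in> carrier A. \<forall>z \<in> carrier A. \<theta> (z \<otimes>\<^bsub>A\<^esub> b) = (\<lambda>x \<in> carrier A. \<theta> z (b \<otimes>\<^bsub>A\<^esub> x)))"

locale symmetric_algebra = fin_dim_algebra K A for K (structure) and A (structure) +
  assumes iso_dual: "\<exists>\<theta>. dual_bimodule_iso K A \<theta>"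


section \<open>Three-halves-transitive permutation groups\<close>

text \<open>A permutation group on \<open>\<Omega>\<close> is a subgroup of \<^term>\<open>BijGroup \<Omega>\<close>, acting by evaluation.
  A set of permutations is closed under products for one order of composition iff it is for
  the other, so it does not matter that \<^const>\<open>BijGroup\<close> composes from right to left.\<close>

abbreviation perm_group :: "'a set \<Rightarrow> ('a \<Rightarrow> 'a) set \<Rightarrow> ('a \<Rightarrow> 'a) monoid"
  where "perm_group \<Omega> G \<equiv> (BijGroup \<Omega>)\<lparr>carrier := G\<rparr>"

abbreviation point_stabilizer :: "'a set \<Rightarrow> ('a \<Rightarrow> 'a) set \<Rightarrow> 'a \<Rightarrow> ('a \<Rightarrow> 'a) set"
  where "point_stabilizer \<Omega> G \<alpha> \<equiv> stabilizer (perm_group \<Omega> G) (\<lambda>g. g) \<alpha>"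

definition regular_perm_group :: "'a set \<Rightarrow> ('a \<Rightarrow> 'a) set \<Rightarrow> bool"
  where "regular_perm_group \<Omega> G \<longleftrightarrow>
    subgroup G (BijGroup \<Omega>) \<and>
    transitive_action (perm_group \<Omega> G) \<Omega> (\<lambda>g. g) \<and>
    (\<forall>\<alpha> \<in> \<Omega>. point_stabilizer \<Omega> G \<alpha> = {\<one>\<^bsub>BijGroup \<Omega>\<^esub>})"

definition three_halves_transitive :: "'a set \<Rightarrow> ('a \<Rightarrow> 'a) set \<Rightarrow> bool"
  where "three_halves_transitive \<Omega> G \<longleftrightarrow>
    subgroup G (BijGroup \<Omega>) \<and>
    transitive_action (perm_group \<Omega> G) \<Omega> (\<lambda>g. g) \<and>
    \<not> regular_perm_group \<Omega> G \<and>
    (\<forall>\<alpha> \<in> \<Omega>.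
       \<forall>\<Delta> \<in> orbits (perm_group \<Omega> (point_stabilizer \<Omega> G \<alpha>)) (\<Omega> - {\<alpha>}) (\<lambda>g. g).
       \<forall>\<Delta>' \<in> orbits (perm_group \<Omega> (point_stabilizer \<Omega> G \<alpha>)) (\<Omega> - {\<alpha>}) (\<lambda>g. g).
         card \<Delta> = card \<Delta>')"


section \<open>The permutation module and its endomorphism ring\<close>

text \<open>A function \<open>v\<close> stands for \<open>\<Sum>\<^sub>\<alpha> v(\<alpha>) \<alpha>\<close>. Only the module fields of the record are
  meaningful: there is no product on \<open>K\<Omega>\<close>.\<close>

definition perm_module :: "('k, 'm) ring_scheme \<Rightarrow> 'a set \<Rightarrow> ('k, 'a \<Rightarrow> 'k) module"
  where "perm_module K \<Omega> =
    \<lparr>carrier = \<Omega> \<rightarrow>\<^sub>E carrier K,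
     monoid.mult = undefined,
     one = undefined,
     zero = (\<lambda>\<alpha> \<in> \<Omega>. \<zero>\<^bsub>K\<^esub>),
     add = (\<lambda>v w. \<lambda>\<alpha> \<in> \<Omega>. v \<alpha> \<oplus>\<^bsub>K\<^esub> w \<alpha>),
     smult = (\<lambda>c v. \<lambda>\<alpha> \<in> \<Omega>. c \<otimes>\<^bsub>K\<^esub> v \<alpha>)\<rparr>"

definition perm_basis :: "('k, 'm) ring_scheme \<Rightarrow> 'a set \<Rightarrow> 'a \<Rightarrow> 'a \<Rightarrow> 'k"
  where "perm_basis K \<Omega> \<alpha> = (\<lambda>\<beta> \<in> \<Omega>. if \<beta> = \<alpha> then \<one>\<^bsub>K\<^esub> else \<zero>\<^bsub>K\<^esub>)"

text \<open>\<open>(\<Sum>\<^sub>\<alpha> v(\<alpha>) \<alpha>) \<cdot> g = \<Sum>\<^sub>\<alpha> v(\<alpha>) (\<alpha> \<cdot> g)\<close>, where \<open>\<alpha> \<cdot> g\<close> is the image of \<open>\<alpha>\<close> under \<open>g\<close>.\<close>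

definition perm_act ::
    "('k, 'm) ring_scheme \<Rightarrow> 'a set \<Rightarrow> ('a \<Rightarrow> 'k) \<Rightarrow> ('a \<Rightarrow> 'a) \<Rightarrow> ('a \<Rightarrow> 'k)"
  where "perm_act K \<Omega> v g =
    (\<Oplus>\<^bsub>perm_module K \<Omega>\<^esub>\<alpha>\<in>\<Omega>. v \<alpha> \<odot>\<^bsub>perm_module K \<Omega>\<^esub> perm_basis K \<Omega> (g \<alpha>))"

text \<open>The elements of the group algebra \<open>KG\<close> are the functions \<open>r : G \<rightarrow> K\<close>, standing for
  \<open>\<Sum>\<^sub>g r(g) g\<close>, and act on \<open>K\<Omega>\<close> by linear extension of the action of \<open>G\<close>. The product of
  \<open>KG\<close> does not enter the notion of a \<open>KG\<close>-endomorphism.\<close>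

definition group_algebra_carrier ::
    "('k, 'm) ring_scheme \<Rightarrow> ('a \<Rightarrow> 'a) set \<Rightarrow> (('a \<Rightarrow> 'a) \<Rightarrow> 'k) set"
  where "group_algebra_carrier K G = G \<rightarrow>\<^sub>E carrier K"

definition group_algebra_act ::
    "('k, 'm) ring_scheme \<Rightarrow> 'a set \<Rightarrow> ('a \<Rightarrow> 'a) set \<Rightarrow>
     ('a \<Rightarrow> 'k) \<Rightarrow> (('a \<Rightarrow> 'a) \<Rightarrow> 'k) \<Rightarrow> ('a \<Rightarrow> 'k)"
  where "group_algebra_act K \<Omega> G v r =
    (\<Oplus>\<^bsub>perm_module K \<Omega>\<^esub>g\<in>G. r g \<odot>\<^bsub>perm_module K \<Omega>\<^esub> perm_act K \<Omega> v g)"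

text \<open>Endomorphisms are written on the left, so the product is \<open>(f h)(v) = f (h v)\<close>.\<close>

definition perm_module_End ::
    "('k, 'm) ring_scheme \<Rightarrow> 'a set \<Rightarrow> ('a \<Rightarrow> 'a) set \<Rightarrow>
     ('k, ('a \<Rightarrow> 'k) \<Rightarrow> ('a \<Rightarrow> 'k)) module"
  where "perm_module_End K \<Omega> G = (let V = perm_module K \<Omega> in
    \<lparr>carrier = {f \<in> carrier V \<rightarrow>\<^sub>E carrier V.
        (\<forall>v \<in> carrier V. \<forall>w \<in> carrier V. f (v \<oplus>\<^bsub>V\<^esub> w) = f v \<oplus>\<^bsub>V\<^esub> f w) \<and>
        (\<forall>v \<in> carrier V. \<forall>r \<in> group_algebra_carrier K G.
           f (group_algebra_act K \<Omega> G v r) = group_algebra_act K \<Omega> G (f v) r)},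
     monoid.mult = (\<lambda>f h. compose (carrier V) f h),
     one = (\<lambda>v \<in> carrier V. v),
     zero = (\<lambda>v \<in> carrier V. \<zero>\<^bsub>V\<^esub>),
     add = (\<lambda>f h. \<lambda>v \<in> carrier V. f v \<oplus>\<^bsub>V\<^esub> h v),
     smult = (\<lambda>c f. \<lambda>v \<in> carrier V. c \<odot>\<^bsub>V\<^esub> f v)\<rparr>)"

end

theory Submission
  imports Defs
begin

text \<open>Endomorphisms of \<open>K\<Omega>\<close> are the matrices over \<open>K\<close> that are constant on the orbits of \<open>G\<close> on
\<open>\<Omega> \<times> \<Omega>\<close> (lemmas \<open>endo_mem\<close>, \<open>End_eqI_entry\<close>). Fix a point \<open>\<alpha>\<close> and representatives \<open>R\<close> of the
orbits of its stabilizer off \<open>\<alpha>\<close>, all of the same length \<open>m\<close>, and put \<open>r = |R|\<close>. Such a matrix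
\<open>x\<close> is determined by \<open>x\<^sub>0 = x(\<alpha>, \<alpha>)\<close> and the entries \<open>x(\<alpha>, \<rho>)\<close> with \<open>\<rho> \<in> R\<close>.

The usual trace form \<open>x \<mapsto> x\<^sub>0\<close> degenerates when the characteristic divides \<open>m\<close>, so the entries
off the diagonal have to contribute as well. Write \<open>\<Sigma>x\<close> for the sum of \<open>x(\<alpha>, \<rho>)\<close> over
\<open>\<rho> \<in> R\<close>: each suborbit counts once, rather than \<open>m\<close> times as in a row sum. Consider
\<open>\<sigma>(x) = s x\<^sub>0 + t \<Sigma>x\<close> for scalars \<open>s\<close>, \<open>t\<close>. Because all suborbits have length \<open>m\<close>, one finds

\<open>\<sigma>(x y) = s x\<^sub>0 y\<^sub>0 + t (x\<^sub>0 \<Sigma>y + \<Sigma>x y\<^sub>0 + m \<Sigma>x \<Sigma>y) + (s m - t) \<langle>x, y\<rangle>\<close>,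

where \<open>\<langle>x, y\<rangle>\<close> is the sum of \<open>x(\<alpha>, \<rho>) y(\<rho>, \<alpha>)\<close> over \<open>\<rho> \<in> R\<close> (lemma \<open>form_mult\<close>, with \<open>s m - t = 1\<close>).
The right-hand side is symmetric, since an invariant function of pairs has the same sum over
\<open>(\<alpha>, \<rho>)\<close> as over \<open>(\<rho>, \<alpha>)\<close>. Both the product formula and this last fact would follow by summing over full
suborbits and dividing by \<open>m\<close>, which need not be possible in \<open>K\<close>. They are proved instead by comparing
how often each value of \<open>K\<close> is attained: these are natural numbers, and \<open>m\<close> can be cancelled
(lemmas \<open>finsum_move_transversal\<close> and \<open>finsum_transpose\<close>).

Normalize by \<open>s m - t = 1\<close>. If \<open>b\<^sub>\<rho>\<close> is the transposed orbital matrix of \<open>\<rho>\<close>, then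
\<open>m \<sigma>(x) - \<sigma>(x b\<^sub>\<rho>) = x\<^sub>0 - x(\<alpha>, \<rho>)\<close>, and adding \<open>t\<close> times these functionals to \<open>\<sigma>\<close> gives
\<open>(s + t r) x\<^sub>0\<close>. So as soon as \<open>s + t r \<noteq> 0\<close>, every coordinate functional is of the form
\<open>x \<mapsto> \<sigma>(x d)\<close>; the matrices \<open>d\<close> form a basis dual to the orbital matrices and \<open>\<sigma>\<close> is a
symmetrizing form (lemma \<open>symmetric_algebra_of_dual_bases\<close>). Finally \<open>s\<close> can be chosen: \<open>s = 0\<close>
gives \<open>s + t r = - r\<close>, and if \<open>r = 0\<close> in \<open>K\<close> then \<open>s = 1\<close> gives \<open>s + t r = 1\<close>.\<close>

section \<open>Finite sums in abelian monoids\<close>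

text \<open>Turns an identity between sums in \<open>G\<close> into identities between natural numbers, where
factors that vanish or are not invertible in \<open>G\<close> can still be cancelled.\<close>

lemma (in abelian_monoid) finsum_cong_fibres:
  assumes "finite P" and "finite Q"
    and "f \<in> P \<rightarrow> carrier G" and "g \<in> Q \<rightarrow> carrier G"
    and "\<And>v. card {p \<in> P. f p = v} = card {q \<in> Q. g q = v}"
  shows "(\<Oplus>p\<in>P. f p) = (\<Oplus>q\<in>Q. g q)"
  using assms
proof (induction P arbitrary: Q rule: finite_induct)
  case empty
  then have "Q = {}"
    by (metis (mono_tags, lifting) Collect_empty_eq card_0_eq equals0I finite_subset empty_iff mem_Collect_eq subsetI card.empty)
  then show ?case by simp
next
  case (insert p P)
  have "card {x \<in> insert p P. f x = f p} \<noteq> 0"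
    using insert.hyps by auto
  then have "card {q \<in> Q. g q = f p} \<noteq> 0"
    using insert.prems(4) by metis
  then have "{q \<in> Q. g q = f p} \<noteq> {}"
    by (metis card.empty)
  then obtain q where q: "q \<in> Q" "g q = f p" by blast
  have fibre: "card {x \<in> P. f x = v} = card {x \<in> Q - {q}. g x = v}" for v
  proof (cases "v = f p")
    case True
    have "{x \<in> insert p P. f x = v} = insert p {x \<in> P. f x = v}"
      and "{x \<in> Q. g x = v} = insert q {x \<in> Q - {q}. g x = v}"
      using True q by auto
    then have "Suc (card {x \<in> P. f x = v}) = Suc (card {x \<in> Q - {q}. g x = v})"
      using insert.prems(4)[of v] insert.hyps \<open>finite Q\<close> by simp
    then show ?thesis by simp
  next
    case False
    have "{x \<in> insert p P. f x = v} = {x \<in> P. f x = v}"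
      and "{x \<in> Q. g x = v} = {x \<in> Q - {q}. g x = v}"
      using False q by auto
    then show ?thesis using insert.prems(4)[of v] by simp
  qed
  have "(\<Oplus>x\<in>P. f x) = (\<Oplus>x\<in>Q - {q}. g x)"
    using insert.prems fibre by (intro insert.IH) auto
  moreover have "(\<Oplus>x\<in>insert q (Q - {q}). g x) = g q \<oplus> (\<Oplus>x\<in>Q - {q}. g x)"
    using insert.prems q by (intro finsum_insert) auto
  moreover have "insert q (Q - {q}) = Q" using q by auto
  moreover have "(\<Oplus>x\<in>insert p P. f x) = f p \<oplus> (\<Oplus>x\<in>P. f x)"
    using insert by (intro finsum_insert) auto
  ultimately show ?case using q by simp
qed

lemma (in abelian_monoid) finsum_product:
  assumes "finite A" and "finite B" and "\<And>a b. a \<in> A \<Longrightarrow> b \<in> B \<Longrightarrow> f a b \<in> carrier G"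
  shows "(\<Oplus>a\<in>A. \<Oplus>b\<in>B. f a b) = (\<Oplus>p\<in>A \<times> B. f (fst p) (snd p))"
  using assms(1,3)
proof (induction A rule: finite_induct)
  case empty
  then show ?case by simp
next
  case (insert x A)
  have "(\<Oplus>b\<in>B. f x b) = (\<Oplus>p\<in>Pair x ` B. f (fst p) (snd p))"
    using insert by (subst finsum_reindex) (auto simp: inj_on_def)
  moreover have "insert x A \<times> B = Pair x ` B \<union> A \<times> B" by auto
  moreover have "(\<Oplus>p\<in>Pair x ` B \<union> A \<times> B. f (fst p) (snd p)) =
      (\<Oplus>p\<in>Pair x ` B. f (fst p) (snd p)) \<oplus> (\<Oplus>p\<in>A \<times> B. f (fst p) (snd p))"
    using insert \<open>finite B\<close> by (intro finsum_Un_disjoint) auto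
  moreover have "(\<Oplus>a\<in>insert x A. \<Oplus>b\<in>B. f a b) = (\<Oplus>b\<in>B. f x b) \<oplus> (\<Oplus>a\<in>A. \<Oplus>b\<in>B. f a b)"
    using insert by (intro finsum_insert) (auto intro!: finsum_closed)
  ultimately show ?case using insert by simp
qed

lemma (in abelian_monoid) finsum_swap:
  assumes "finite A" and "finite B" and "\<And>a b. a \<in> A \<Longrightarrow> b \<in> B \<Longrightarrow> f a b \<in> carrier G"
  shows "(\<Oplus>a\<in>A. \<Oplus>b\<in>B. f a b) = (\<Oplus>b\<in>B. \<Oplus>a\<in>A. f a b)"
proof -
  have "(\<Oplus>p\<in>B \<times> A. f (snd p) (fst p)) = (\<Oplus>p\<in>prod.swap ` (B \<times> A). f (fst p) (snd p))"
    using assms by (subst finsum_reindex) (auto simp: inj_on_def)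
  then show ?thesis
    using assms by (simp add: finsum_product product_swap)
qed

lemma (in abelian_monoid) finsum_delta:
  assumes "finite A" and "b \<in> A" and "f b \<in> carrier G"
  shows "(\<Oplus>a\<in>A. if a = b then f a else \<zero>) = f b"
proof -
  have "(\<Oplus>a\<in>A. if a = b then f a else \<zero>) = (\<Oplus>a\<in>A. if b = a then f b else \<zero>)"
    using assms by (intro finsum_cong') auto
  also have "\<dots> = f b"
    using finsum_singleton[of b A "\<lambda>_. f b"] assms by auto
  finally show ?thesis .
qed

section \<open>Dual bases for a trace form\<close>

context fin_dim_algebra
begin

lemma linear_functional_finsum:
  assumes "finite J" and "c \<in> J \<rightarrow> carrier K" and "w \<in> J \<rightarrow> carrier A"
    and closed: "\<phi> \<in> carrier A \<rightarrow> carrier K"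
    and add: "\<And>x y. x \<in> carrier A \<Longrightarrow> y \<in> carrier A \<Longrightarrow> \<phi> (x \<oplus>\<^bsub>A\<^esub> y) = \<phi> x \<oplus>\<^bsub>K\<^esub> \<phi> y"
    and smult: "\<And>c x. c \<in> carrier K \<Longrightarrow> x \<in> carrier A \<Longrightarrow> \<phi> (c \<odot>\<^bsub>A\<^esub> x) = c \<otimes>\<^bsub>K\<^esub> \<phi> x"
  shows "\<phi> (\<Oplus>\<^bsub>A\<^esub>i\<in>J. c i \<odot>\<^bsub>A\<^esub> w i) = (\<Oplus>\<^bsub>K\<^esub>i\<in>J. c i \<otimes>\<^bsub>K\<^esub> \<phi> (w i))"
  using assms(1-3)
proof (induction J rule: finite_induct)
  case empty
  have "\<phi> \<zero>\<^bsub>A\<^esub> = \<phi> (\<zero>\<^bsub>K\<^esub> \<odot>\<^bsub>A\<^esub> \<zero>\<^bsub>A\<^esub>)" by simp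
  also have "\<dots> = \<zero>\<^bsub>K\<^esub>" using closed by (subst smult) (auto simp: Pi_iff)
  finally show ?case by simp
next
  case (insert x J)
  then have "(\<lambda>i. c i \<odot>\<^bsub>A\<^esub> w i) \<in> J \<rightarrow> carrier A" "(\<lambda>i. c i \<otimes>\<^bsub>K\<^esub> \<phi> (w i)) \<in> J \<rightarrow> carrier K"
    "c x \<in> carrier K" "w x \<in> carrier A" "\<phi> (w x) \<in> carrier K"
    using closed by (auto simp: Pi_iff)
  then show ?case
    using insert add smult by simp
qed

text \<open>The isomorphism onto the dual sends \<open>z\<close> to \<open>x \<mapsto> \<sigma>(x z)\<close>. A functional \<open>\<phi>\<close> is the image of
\<open>\<Sum>\<^sub>i \<phi>(b\<^sub>i) d\<^sub>i\<close>. Injectivity follows without a dimension count: by symmetry \<open>\<sigma>(z d\<^sub>i)\<close> is the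
\<open>i\<close>-th coordinate of \<open>z\<close>, so the image of \<open>z\<close> determines \<open>z\<close>.\<close>

lemma symmetric_algebra_of_dual_bases:
  assumes "finite I"
    and b: "\<And>i. i \<in> I \<Longrightarrow> b i \<in> carrier A"
    and \<epsilon>: "\<And>i. i \<in> I \<Longrightarrow> \<epsilon> i \<in> carrier A \<rightarrow> carrier K"
    and expand: "\<And>x. x \<in> carrier A \<Longrightarrow> x = (\<Oplus>\<^bsub>A\<^esub>i\<in>I. \<epsilon> i x \<odot>\<^bsub>A\<^esub> b i)"
    and closed: "\<sigma> \<in> carrier A \<rightarrow> carrier K"
    and add: "\<And>x y. x \<in> carrier A \<Longrightarrow> y \<in> carrier A \<Longrightarrow> \<sigma> (x \<oplus>\<^bsub>A\<^esub> y) = \<sigma> x \<oplus>\<^bsub>K\<^esub> \<sigma> y"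
    and smult: "\<And>c x. c \<in> carrier K \<Longrightarrow> x \<in> carrier A \<Longrightarrow> \<sigma> (c \<odot>\<^bsub>A\<^esub> x) = c \<otimes>\<^bsub>K\<^esub> \<sigma> x"
    and sym: "\<And>x y. x \<in> carrier A \<Longrightarrow> y \<in> carrier A \<Longrightarrow> \<sigma> (x \<otimes>\<^bsub>A\<^esub> y) = \<sigma> (y \<otimes>\<^bsub>A\<^esub> x)"
    and d: "\<And>i. i \<in> I \<Longrightarrow> d i \<in> carrier A"
    and dual: "\<And>i x. i \<in> I \<Longrightarrow> x \<in> carrier A \<Longrightarrow> \<sigma> (x \<otimes>\<^bsub>A\<^esub> d i) = \<epsilon> i x"
  shows "symmetric_algebra K A"
proof -
  define \<theta> where "\<theta> z = (\<lambda>x\<in>carrier A. \<sigma> (x \<otimes>\<^bsub>A\<^esub> z))" for z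
  have \<theta>_dual: "\<theta> z \<in> dual_space K A" if "z \<in> carrier A" for z
    using that closed unfolding dual_space_def \<theta>_def
    by (auto simp: A.l_distr add smult smult_mult_left)
  have inj: "z = z'" if z: "z \<in> carrier A" "z' \<in> carrier A" "\<theta> z = \<theta> z'" for z z'
  proof -
    have "\<epsilon> i z = \<epsilon> i z'" if "i \<in> I" for i
    proof -
      have "\<theta> z (d i) = \<theta> z' (d i)" using z by simp
      then show ?thesis
        using that z d dual sym by (simp add: \<theta>_def)
    qed
    then have "(\<Oplus>\<^bsub>A\<^esub>i\<in>I. \<epsilon> i z \<odot>\<^bsub>A\<^esub> b i) = (\<Oplus>\<^bsub>A\<^esub>i\<in>I. \<epsilon> i z' \<odot>\<^bsub>A\<^esub> b i)"
      using b \<epsilon> z by (intro M.finsum_cong') (auto simp: Pi_iff)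
    then show ?thesis using expand z by metis
  qed
  have surj: "\<exists>z\<in>carrier A. \<theta> z = \<phi>" if "\<phi> \<in> dual_space K A" for \<phi>
  proof -
    from that have \<phi>: "\<phi> \<in> carrier A \<rightarrow>\<^sub>E carrier K"
      "\<And>x y. x \<in> carrier A \<Longrightarrow> y \<in> carrier A \<Longrightarrow> \<phi> (x \<oplus>\<^bsub>A\<^esub> y) = \<phi> x \<oplus>\<^bsub>K\<^esub> \<phi> y"
      "\<And>c x. c \<in> carrier K \<Longrightarrow> x \<in> carrier A \<Longrightarrow> \<phi> (c \<odot>\<^bsub>A\<^esub> x) = c \<otimes>\<^bsub>K\<^esub> \<phi> x"
      by (auto simp: dual_space_def)
    have \<phi>_closed: "\<phi> \<in> carrier A \<rightarrow> carrier K" using \<phi>(1) by auto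
    have \<phi>b: "\<phi> (b i) \<in> carrier K" if "i \<in> I" for i using \<phi>_closed b that by auto
    have \<phi>b': "(\<lambda>i. \<phi> (b i)) \<in> I \<rightarrow> carrier K" using \<phi>b by auto
    define z where "z = (\<Oplus>\<^bsub>A\<^esub>i\<in>I. \<phi> (b i) \<odot>\<^bsub>A\<^esub> d i)"
    have z: "z \<in> carrier A"
      unfolding z_def using \<phi>b d by (intro M.finsum_closed) auto
    have "\<theta> z x = \<phi> x" if x: "x \<in> carrier A" for x
    proof -
      have "\<sigma> (x \<otimes>\<^bsub>A\<^esub> z) = (\<Oplus>\<^bsub>K\<^esub>i\<in>I. \<phi> (b i) \<otimes>\<^bsub>K\<^esub> \<sigma> (x \<otimes>\<^bsub>A\<^esub> d i))"
        unfolding z_def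
        using \<open>finite I\<close> \<phi>b' d x closed
        by (intro linear_functional_finsum[where \<phi> = "\<lambda>y. \<sigma> (x \<otimes>\<^bsub>A\<^esub> y)"])
          (auto simp: A.r_distr add smult smult_mult_right)
      also have "\<dots> = (\<Oplus>\<^bsub>K\<^esub>i\<in>I. \<epsilon> i x \<otimes>\<^bsub>K\<^esub> \<phi> (b i))"
        using \<phi>b \<epsilon> x by (intro K.finsum_cong') (auto simp: dual K.m_comm Pi_iff)
      also have "\<dots> = \<phi> (\<Oplus>\<^bsub>A\<^esub>i\<in>I. \<epsilon> i x \<odot>\<^bsub>A\<^esub> b i)"
        using \<open>finite I\<close> b \<epsilon> x \<phi>_closed \<phi>(2,3) by (intro linear_functional_finsum[symmetric]) (auto simp: Pi_iff)
      also have "\<dots> = \<phi> x" using expand[OF x] by simp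
      finally show ?thesis using x by (simp add: \<theta>_def)
    qed
    then have "\<theta> z = \<phi>"
      using \<phi>(1) by (intro ext) (auto simp: \<theta>_def PiE_def extensional_def)
    then show ?thesis using z by blast
  qed
  have "dual_bimodule_iso K A \<theta>"
    unfolding dual_bimodule_iso_def
  proof (intro conjI ballI)
    show "bij_betw \<theta> (carrier A) (dual_space K A)"
      unfolding bij_betw_def using \<theta>_dual surj by (auto intro!: inj_onI inj)
  next
    fix a z assume "a \<in> carrier A" "z \<in> carrier A"
    then show "\<theta> (a \<otimes>\<^bsub>A\<^esub> z) = (\<lambda>x\<in>carrier A. \<theta> z (x \<otimes>\<^bsub>A\<^esub> a))"
      by (auto simp: \<theta>_def A.m_assoc intro!: restrict_ext)
  next
    fix a z assume "a \<in> carrier A" "z \<in> carrier A"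
    then show "\<theta> (z \<otimes>\<^bsub>A\<^esub> a) = (\<lambda>x\<in>carrier A. \<theta> z (a \<otimes>\<^bsub>A\<^esub> x))"
      by (auto simp: \<theta>_def A.m_assoc sym[of a] intro!: restrict_ext)
  qed (auto simp: \<theta>_def A.r_distr add smult smult_mult_right intro!: restrict_ext)
  then show ?thesis
    by (intro symmetric_algebra.intro symmetric_algebra_axioms.intro fin_dim_algebra_axioms) auto
qed

end

section \<open>Permutation modules and matrices of their endomorphisms\<close>

locale permutation_representation = field K for K (structure) +
  fixes \<Omega> :: "'a set" and G :: "('a \<Rightarrow> 'a) set"
  assumes finite_domain: "finite \<Omega>"
    and subgroup: "subgroup G (BijGroup \<Omega>)"
begin

abbreviation "V \<equiv> perm_module K \<Omega>"
abbreviation "E \<equiv> perm_module_End K \<Omega> G"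
abbreviation e where "e \<equiv> perm_basis K \<Omega>"

lemma perm_in_Bij: "g \<in> G \<Longrightarrow> g \<in> Bij \<Omega>"
  using subgroup.subset[OF subgroup] by (auto simp: BijGroup_def)

lemma bij_perm: "g \<in> G \<Longrightarrow> bij_betw g \<Omega> \<Omega>"
  using perm_in_Bij by (auto simp: Bij_def)

lemma perm_closed [simp]: "g \<in> G \<Longrightarrow> \<beta> \<in> \<Omega> \<Longrightarrow> g \<beta> \<in> \<Omega>"
  using bij_perm bij_betwE by blast

lemma perm_eq_iff: "g \<in> G \<Longrightarrow> \<beta> \<in> \<Omega> \<Longrightarrow> \<gamma> \<in> \<Omega> \<Longrightarrow> g \<beta> = g \<gamma> \<longleftrightarrow> \<beta> = \<gamma>"
  using bij_perm by (metis bij_betw_imp_inj_on inj_on_eq_iff)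

lemma finite_perms: "finite G"
proof (rule finite_subset)
  show "G \<subseteq> (\<Omega> \<rightarrow>\<^sub>E \<Omega>)"
    using perm_in_Bij bij_perm by (force simp: Bij_def PiE_def dest: bij_betwE)
  show "finite (\<Omega> \<rightarrow>\<^sub>E \<Omega>)"
    using finite_domain by (intro finite_PiE)
qed

lemma id_mem: "(\<lambda>\<beta>\<in>\<Omega>. \<beta>) \<in> G"
  using subgroup.one_closed[OF subgroup] by (simp add: BijGroup_def)

lemma comp_mem: "g \<in> G \<Longrightarrow> h \<in> G \<Longrightarrow> compose \<Omega> g h \<in> G"
  using subgroup.m_closed[OF subgroup, of g h] perm_in_Bij by (simp add: BijGroup_def)

lemma inverse_mem: "g \<in> G \<Longrightarrow> (\<lambda>\<beta>\<in>\<Omega>. inv_into \<Omega> g \<beta>) \<in> G"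
  using subgroup.m_inv_closed[OF subgroup, of g] perm_in_Bij by (simp add: inv_BijGroup)

lemma inv_perm [simp]:
  assumes "g \<in> G" "\<beta> \<in> \<Omega>"
  shows "inv_into \<Omega> g \<beta> \<in> \<Omega>" "g (inv_into \<Omega> g \<beta>) = \<beta>" "inv_into \<Omega> g (g \<beta>) = \<beta>"
  using assms bij_perm[of g]
  by (auto simp: bij_betw_def inv_into_into f_inv_into_f)

lemma V_simps [simp]:
  "carrier V = \<Omega> \<rightarrow>\<^sub>E carrier K"
  "\<zero>\<^bsub>V\<^esub> = (\<lambda>\<alpha>\<in>\<Omega>. \<zero>)"
  "v \<oplus>\<^bsub>V\<^esub> w = (\<lambda>\<alpha>\<in>\<Omega>. v \<alpha> \<oplus> w \<alpha>)"
  "c \<odot>\<^bsub>V\<^esub> v = (\<lambda>\<alpha>\<in>\<Omega>. c \<otimes> v \<alpha>)"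
  by (simp_all add: perm_module_def)

lemma V_closed: "v \<in> \<Omega> \<rightarrow>\<^sub>E carrier K \<Longrightarrow> \<beta> \<in> \<Omega> \<Longrightarrow> v \<beta> \<in> carrier K"
  by auto

lemma V_eqI: "\<lbrakk>v \<in> \<Omega> \<rightarrow>\<^sub>E carrier K; w \<in> \<Omega> \<rightarrow>\<^sub>E carrier K; \<And>\<beta>. \<beta> \<in> \<Omega> \<Longrightarrow> v \<beta> = w \<beta>\<rbrakk> \<Longrightarrow> v = w"
  by (rule PiE_ext)

lemma module_V: "module K V"
proof (rule moduleI)
  show "cring K" by (rule is_cring)
  show "abelian_group V"
  proof (rule abelian_groupI)
    fix v assume v: "v \<in> carrier V"
    show "\<exists>w\<in>carrier V. w \<oplus>\<^bsub>V\<^esub> v = \<zero>\<^bsub>V\<^esub>"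
      using v by (intro bexI[where x = "\<lambda>\<alpha>\<in>\<Omega>. \<ominus> v \<alpha>"]) (auto simp: l_neg PiE_iff intro!: restrict_ext)
  qed (auto simp: a_ac PiE_iff extensional_def fun_eq_iff)
qed (auto simp: l_distr r_distr m_assoc PiE_iff extensional_def fun_eq_iff)

sublocale V: module K V
  by (rule module_V)

lemma V_finsum_apply:
  assumes "finite I" and "w \<in> I \<rightarrow> carrier V" and "\<beta> \<in> \<Omega>"
  shows "(\<Oplus>\<^bsub>V\<^esub>i\<in>I. w i) \<beta> = (\<Oplus>i\<in>I. w i \<beta>)"
  using assms(1,2)
proof (induction I rule: finite_induct)
  case empty
  then show ?case using \<open>\<beta> \<in> \<Omega>\<close> by simp
next
  case (insert x I)
  then have "(\<Oplus>\<^bsub>V\<^esub>i\<in>insert x I. w i) = w x \<oplus>\<^bsub>V\<^esub> (\<Oplus>\<^bsub>V\<^esub>i\<in>I. w i)"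
    by (intro V.finsum_insert) auto
  moreover have "(\<Oplus>i\<in>insert x I. w i \<beta>) = w x \<beta> \<oplus> (\<Oplus>i\<in>I. w i \<beta>)"
    using insert \<open>\<beta> \<in> \<Omega>\<close> by (intro finsum_insert) (auto simp: PiE_iff Pi_iff)
  ultimately show ?case using insert \<open>\<beta> \<in> \<Omega>\<close> by simp
qed

lemma basis_mem [simp]: "e \<beta> \<in> \<Omega> \<rightarrow>\<^sub>E carrier K"
  by (auto simp: perm_basis_def)

lemma V_expand:
  assumes "v \<in> carrier V"
  shows "v = (\<Oplus>\<^bsub>V\<^esub>\<delta>\<in>\<Omega>. v \<delta> \<odot>\<^bsub>V\<^esub> e \<delta>)"
proof (rule V_eqI)
  have mem: "(\<lambda>\<delta>. v \<delta> \<odot>\<^bsub>V\<^esub> e \<delta>) \<in> \<Omega> \<rightarrow> carrier V"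
    using assms basis_mem by (auto simp: PiE_iff Pi_iff)
  show "(\<Oplus>\<^bsub>V\<^esub>\<delta>\<in>\<Omega>. v \<delta> \<odot>\<^bsub>V\<^esub> e \<delta>) \<in> \<Omega> \<rightarrow>\<^sub>E carrier K"
    using V.finsum_closed[OF mem] by simp
  fix \<beta> assume \<beta>: "\<beta> \<in> \<Omega>"
  have "(\<Oplus>\<^bsub>V\<^esub>\<delta>\<in>\<Omega>. v \<delta> \<odot>\<^bsub>V\<^esub> e \<delta>) \<beta> = (\<Oplus>\<delta>\<in>\<Omega>. (v \<delta> \<odot>\<^bsub>V\<^esub> e \<delta>) \<beta>)"
    using finite_domain mem \<beta> by (rule V_finsum_apply)
  also have "\<dots> = (\<Oplus>\<delta>\<in>\<Omega>. if \<delta> = \<beta> then v \<delta> else \<zero>)"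
    using assms \<beta> by (intro finsum_cong') (auto simp: perm_basis_def PiE_iff)
  also have "\<dots> = v \<beta>"
    using assms \<beta> finite_domain by (intro finsum_delta) auto
  finally show "v \<beta> = (\<Oplus>\<^bsub>V\<^esub>\<delta>\<in>\<Omega>. v \<delta> \<odot>\<^bsub>V\<^esub> e \<delta>) \<beta>" by simp
qed (use assms in simp)

text \<open>The coefficient of \<open>\<beta>\<close> in \<open>v \<cdot> g\<close> is that of the point which \<open>g\<close> carries to \<open>\<beta>\<close>.\<close>

lemma perm_act_eq:
  assumes "v \<in> carrier V" and "g \<in> G"
  shows "perm_act K \<Omega> v g = (\<lambda>\<beta>\<in>\<Omega>. v (inv_into \<Omega> g \<beta>))"
proof (rule V_eqI)
  have mem: "(\<lambda>\<delta>. v \<delta> \<odot>\<^bsub>V\<^esub> e (g \<delta>)) \<in> \<Omega> \<rightarrow> carrier V"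
    using assms by (auto simp: perm_basis_def PiE_iff)
  show "perm_act K \<Omega> v g \<in> \<Omega> \<rightarrow>\<^sub>E carrier K"
    using V.finsum_closed[OF mem] by (simp add: perm_act_def)
  show "(\<lambda>\<beta>\<in>\<Omega>. v (inv_into \<Omega> g \<beta>)) \<in> \<Omega> \<rightarrow>\<^sub>E carrier K"
    using assms by (auto intro!: V_closed)
  fix \<beta> assume \<beta>: "\<beta> \<in> \<Omega>"
  have "perm_act K \<Omega> v g \<beta> = (\<Oplus>\<delta>\<in>\<Omega>. (v \<delta> \<odot>\<^bsub>V\<^esub> e (g \<delta>)) \<beta>)"
    unfolding perm_act_def using finite_domain mem \<beta> by (rule V_finsum_apply)
  also have "\<dots> = (\<Oplus>\<delta>\<in>\<Omega>. if \<delta> = inv_into \<Omega> g \<beta> then v \<delta> else \<zero>)"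
    using assms \<beta> by (intro finsum_cong') (auto simp: perm_basis_def PiE_iff)
  also have "\<dots> = v (inv_into \<Omega> g \<beta>)"
    using assms \<beta> finite_domain by (intro finsum_delta) (auto intro!: V_closed)
  finally show "perm_act K \<Omega> v g \<beta> = (\<lambda>\<beta>\<in>\<Omega>. v (inv_into \<Omega> g \<beta>)) \<beta>" using \<beta> by simp
qed

lemma group_algebra_act_eq:
  assumes v: "v \<in> carrier V" and r: "r \<in> group_algebra_carrier K G"
  shows "group_algebra_act K \<Omega> G v r = (\<lambda>\<beta>\<in>\<Omega>. \<Oplus>g\<in>G. r g \<otimes> v (inv_into \<Omega> g \<beta>))"
proof (rule V_eqI)
  have mem: "(\<lambda>g. r g \<odot>\<^bsub>V\<^esub> perm_act K \<Omega> v g) \<in> G \<rightarrow> carrier V"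
    using assms by (auto simp: perm_act_eq group_algebra_carrier_def PiE_iff)
  show "group_algebra_act K \<Omega> G v r \<in> \<Omega> \<rightarrow>\<^sub>E carrier K"
    using V.finsum_closed[OF mem] by (simp add: group_algebra_act_def)
  show "(\<lambda>\<beta>\<in>\<Omega>. \<Oplus>g\<in>G. r g \<otimes> v (inv_into \<Omega> g \<beta>)) \<in> \<Omega> \<rightarrow>\<^sub>E carrier K"
    using assms by (auto intro!: finsum_closed simp: group_algebra_carrier_def PiE_iff)
  fix \<beta> assume \<beta>: "\<beta> \<in> \<Omega>"
  have "group_algebra_act K \<Omega> G v r \<beta> = (\<Oplus>g\<in>G. (r g \<odot>\<^bsub>V\<^esub> perm_act K \<Omega> v g) \<beta>)"
    unfolding group_algebra_act_def using finite_perms mem \<beta> by (rule V_finsum_apply)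
  also have "\<dots> = (\<Oplus>g\<in>G. r g \<otimes> v (inv_into \<Omega> g \<beta>))"
    using assms \<beta> by (intro finsum_cong') (auto simp: perm_act_eq group_algebra_carrier_def PiE_iff)
  finally show "group_algebra_act K \<Omega> G v r \<beta> = (\<lambda>\<beta>\<in>\<Omega>. \<Oplus>g\<in>G. r g \<otimes> v (inv_into \<Omega> g \<beta>)) \<beta>"
    using \<beta> by simp
qed

lemma group_algebra_act_closed:
  assumes v: "v \<in> carrier V" and r: "r \<in> group_algebra_carrier K G"
  shows "group_algebra_act K \<Omega> G v r \<in> carrier V"
  using assms by (auto simp: group_algebra_act_eq group_algebra_carrier_def PiE_iff intro!: finsum_closed)

text \<open>The action of \<open>c g\<close>: with \<open>g = 1\<close> it yields the scalars and with \<open>c = 1\<close> the group elements.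
This is how linearity over \<open>K\<close> and invariance under \<open>G\<close> are extracted from linearity over \<open>KG\<close>.\<close>

lemma group_algebra_act_single:
  assumes v: "v \<in> carrier V" and g: "g \<in> G" and c: "c \<in> carrier K"
  shows "group_algebra_act K \<Omega> G v (\<lambda>h\<in>G. if h = g then c else \<zero>) = c \<odot>\<^bsub>V\<^esub> perm_act K \<Omega> v g"
proof -
  have "(\<Oplus>h\<in>G. (\<lambda>h\<in>G. if h = g then c else \<zero>) h \<otimes> v (inv_into \<Omega> h \<beta>)) =
      c \<otimes> v (inv_into \<Omega> g \<beta>)" if \<beta>: "\<beta> \<in> \<Omega>" for \<beta>
  proof -
    have "(\<Oplus>h\<in>G. (\<lambda>h\<in>G. if h = g then c else \<zero>) h \<otimes> v (inv_into \<Omega> h \<beta>)) =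
        (\<Oplus>h\<in>G. if h = g then c \<otimes> v (inv_into \<Omega> h \<beta>) else \<zero>)"
      using v c \<beta> by (intro finsum_cong') (auto simp: PiE_iff)
    also have "\<dots> = c \<otimes> v (inv_into \<Omega> g \<beta>)"
      using v g c \<beta> finite_perms by (intro finsum_delta) (auto simp: PiE_iff)
    finally show ?thesis .
  qed
  moreover have "(\<lambda>h\<in>G. if h = g then c else \<zero>) \<in> group_algebra_carrier K G"
    using c by (auto simp: group_algebra_carrier_def)
  ultimately show ?thesis
    using v g by (auto simp: group_algebra_act_eq perm_act_eq intro!: restrict_ext)
qed

lemma perm_act_id:
  assumes "v \<in> carrier V"
  shows "perm_act K \<Omega> v (\<lambda>\<beta>\<in>\<Omega>. \<beta>) = v"
proof -
  have "inv_into \<Omega> (\<lambda>\<beta>\<in>\<Omega>. \<beta>) \<beta> = \<beta>" if "\<beta> \<in> \<Omega>" for \<beta>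
    using inv_perm(3)[OF id_mem that] that by simp
  then show ?thesis
    using assms by (auto simp: perm_act_eq id_mem PiE_iff extensional_def fun_eq_iff)
qed

lemma perm_act_basis:
  assumes "g \<in> G" and "\<delta> \<in> \<Omega>"
  shows "perm_act K \<Omega> (e \<delta>) g = e (g \<delta>)"
  using assms by (subst perm_act_eq) (auto simp: perm_basis_def fun_eq_iff)

lemma End_simps [simp]:
  "f \<otimes>\<^bsub>E\<^esub> h = compose (carrier V) f h"
  "\<one>\<^bsub>E\<^esub> = (\<lambda>v\<in>carrier V. v)"
  "\<zero>\<^bsub>E\<^esub> = (\<lambda>v\<in>carrier V. \<zero>\<^bsub>V\<^esub>)"
  "f \<oplus>\<^bsub>E\<^esub> h = (\<lambda>v\<in>carrier V. f v \<oplus>\<^bsub>V\<^esub> h v)"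
  "c \<odot>\<^bsub>E\<^esub> f = (\<lambda>v\<in>carrier V. c \<odot>\<^bsub>V\<^esub> f v)"
  by (simp_all add: perm_module_End_def Let_def)

lemma End_carrier:
  "f \<in> carrier E \<longleftrightarrow> f \<in> carrier V \<rightarrow>\<^sub>E carrier V \<and>
    (\<forall>v \<in> carrier V. \<forall>w \<in> carrier V. f (v \<oplus>\<^bsub>V\<^esub> w) = f v \<oplus>\<^bsub>V\<^esub> f w) \<and>
    (\<forall>v \<in> carrier V. \<forall>r \<in> group_algebra_carrier K G.
       f (group_algebra_act K \<Omega> G v r) = group_algebra_act K \<Omega> G (f v) r)"
  by (simp add: perm_module_End_def Let_def)

lemma End_closed: "f \<in> carrier E \<Longrightarrow> v \<in> carrier V \<Longrightarrow> f v \<in> carrier V"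
  by (auto simp: End_carrier simp del: V_simps)

lemma End_add: "f \<in> carrier E \<Longrightarrow> v \<in> carrier V \<Longrightarrow> w \<in> carrier V \<Longrightarrow> f (v \<oplus>\<^bsub>V\<^esub> w) = f v \<oplus>\<^bsub>V\<^esub> f w"
  by (auto simp: End_carrier simp del: V_simps)

lemma End_single:
  assumes "f \<in> carrier E" and "v \<in> carrier V" and "g \<in> G" and "c \<in> carrier K"
  shows "f (c \<odot>\<^bsub>V\<^esub> perm_act K \<Omega> v g) = c \<odot>\<^bsub>V\<^esub> perm_act K \<Omega> (f v) g"
proof -
  have "(\<lambda>h\<in>G. if h = g then c else \<zero>) \<in> group_algebra_carrier K G"
    using assms by (auto simp: group_algebra_carrier_def)
  then have "f (group_algebra_act K \<Omega> G v (\<lambda>h\<in>G. if h = g then c else \<zero>)) =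
      group_algebra_act K \<Omega> G (f v) (\<lambda>h\<in>G. if h = g then c else \<zero>)"
    using assms by (simp add: End_carrier del: V_simps)
  then show ?thesis
    using assms End_closed by (simp add: group_algebra_act_single del: V_simps)
qed

lemma End_smult:
  assumes "f \<in> carrier E" and "v \<in> carrier V" and "c \<in> carrier K"
  shows "f (c \<odot>\<^bsub>V\<^esub> v) = c \<odot>\<^bsub>V\<^esub> f v"
  using End_single[OF assms(1,2) id_mem assms(3)] assms End_closed
  by (simp add: perm_act_id del: V_simps)

lemma End_perm_act:
  assumes f: "f \<in> carrier E" and v: "v \<in> carrier V" and g: "g \<in> G"
  shows "f (perm_act K \<Omega> v g) = perm_act K \<Omega> (f v) g"
proof -
  have "perm_act K \<Omega> w g \<in> carrier V" if "w \<in> carrier V" for w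
    using that g by (auto simp: perm_act_eq PiE_iff)
  then show ?thesis
    using End_single[OF f v g one_closed] f v End_closed by (simp del: V_simps)
qed

lemma End_finsum:
  assumes f: "f \<in> carrier E" and "finite I" and "c \<in> I \<rightarrow> carrier K" and "w \<in> I \<rightarrow> carrier V"
  shows "f (\<Oplus>\<^bsub>V\<^esub>i\<in>I. c i \<odot>\<^bsub>V\<^esub> w i) = (\<Oplus>\<^bsub>V\<^esub>i\<in>I. c i \<odot>\<^bsub>V\<^esub> f (w i))"
  using assms(2-)
proof (induction I rule: finite_induct)
  case empty
  have "f (\<zero> \<odot>\<^bsub>V\<^esub> \<zero>\<^bsub>V\<^esub>) = \<zero> \<odot>\<^bsub>V\<^esub> f \<zero>\<^bsub>V\<^esub>"
    using f by (intro End_smult) (simp_all del: V_simps)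
  then show ?case using End_closed[OF f, of "\<zero>\<^bsub>V\<^esub>"] by (simp del: V_simps)
next
  case (insert x I)
  then have *: "(\<lambda>i. c i \<odot>\<^bsub>V\<^esub> w i) \<in> I \<rightarrow> carrier V" "(\<lambda>i. c i \<odot>\<^bsub>V\<^esub> f (w i)) \<in> I \<rightarrow> carrier V"
    "c x \<in> carrier K" "w x \<in> carrier V" "f (w x) \<in> carrier V"
    "c \<in> I \<rightarrow> carrier K" "w \<in> I \<rightarrow> carrier V"
    using End_closed[OF f] by (auto simp: Pi_iff simp del: V_simps)
  then show ?case
    using insert.hyps insert.IH f by (simp add: End_add End_smult del: V_simps)
qed

text \<open>Endomorphisms act on column vectors, so that products of endomorphisms correspond to
products of matrices in the same order.\<close>

definition entry :: "(('a \<Rightarrow> 'b) \<Rightarrow> 'a \<Rightarrow> 'b) \<Rightarrow> 'a \<Rightarrow> 'a \<Rightarrow> 'b"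
  where "entry f \<gamma> \<delta> = f (e \<delta>) \<gamma>"

lemma entry_closed: "f \<in> carrier E \<Longrightarrow> \<gamma> \<in> \<Omega> \<Longrightarrow> \<delta> \<in> \<Omega> \<Longrightarrow> entry f \<gamma> \<delta> \<in> carrier K"
  using End_closed[of f "e \<delta>"] by (auto simp: entry_def)

lemma entry_invariant:
  assumes "f \<in> carrier E" and "g \<in> G" and "\<gamma> \<in> \<Omega>" and "\<delta> \<in> \<Omega>"
  shows "entry f (g \<gamma>) (g \<delta>) = entry f \<gamma> \<delta>"
proof -
  have "f (e (g \<delta>)) = perm_act K \<Omega> (f (e \<delta>)) g"
    using End_perm_act[of f "e \<delta>" g] assms by (simp add: perm_act_basis)
  also have "\<dots> = (\<lambda>\<beta>\<in>\<Omega>. f (e \<delta>) (inv_into \<Omega> g \<beta>))"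
    using assms End_closed[of f "e \<delta>"] by (intro perm_act_eq) simp_all
  finally show ?thesis using assms by (simp add: entry_def)
qed

lemma apply_entry:
  assumes f: "f \<in> carrier E" and v: "v \<in> carrier V" and \<gamma>: "\<gamma> \<in> \<Omega>"
  shows "f v \<gamma> = (\<Oplus>\<delta>\<in>\<Omega>. entry f \<gamma> \<delta> \<otimes> v \<delta>)"
proof -
  have v': "v \<in> \<Omega> \<rightarrow> carrier K" using v by auto
  have fe: "f (e \<delta>) \<in> \<Omega> \<rightarrow>\<^sub>E carrier K" for \<delta>
    using End_closed[OF f, of "e \<delta>"] by simp
  have "f v = f (\<Oplus>\<^bsub>V\<^esub>\<delta>\<in>\<Omega>. v \<delta> \<odot>\<^bsub>V\<^esub> e \<delta>)"
    using V_expand[OF v] by simp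
  also have "\<dots> = (\<Oplus>\<^bsub>V\<^esub>\<delta>\<in>\<Omega>. v \<delta> \<odot>\<^bsub>V\<^esub> f (e \<delta>))"
    using f v' finite_domain by (intro End_finsum) auto
  finally have "f v \<gamma> = (\<Oplus>\<^bsub>V\<^esub>\<delta>\<in>\<Omega>. v \<delta> \<odot>\<^bsub>V\<^esub> f (e \<delta>)) \<gamma>"
    by (rule arg_cong)
  also have "\<dots> = (\<Oplus>\<delta>\<in>\<Omega>. (v \<delta> \<odot>\<^bsub>V\<^esub> f (e \<delta>)) \<gamma>)"
    using finite_domain v' fe \<gamma> by (intro V_finsum_apply) (auto simp: PiE_iff Pi_iff)
  also have "\<dots> = (\<Oplus>\<delta>\<in>\<Omega>. entry f \<gamma> \<delta> \<otimes> v \<delta>)"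
    using v' fe \<gamma> by (intro finsum_cong') (auto simp: entry_def PiE_iff Pi_iff m_comm)
  finally show ?thesis .
qed

lemma End_eqI_entry:
  assumes f: "f \<in> carrier E" and h: "h \<in> carrier E"
    and eq: "\<And>\<gamma> \<delta>. \<gamma> \<in> \<Omega> \<Longrightarrow> \<delta> \<in> \<Omega> \<Longrightarrow> entry f \<gamma> \<delta> = entry h \<gamma> \<delta>"
  shows "f = h"
proof (rule PiE_ext)
  show "f \<in> carrier V \<rightarrow>\<^sub>E carrier V" "h \<in> carrier V \<rightarrow>\<^sub>E carrier V"
    using f h by (simp_all add: End_carrier)
  fix v assume v: "v \<in> carrier V"
  show "f v = h v"
  proof (rule V_eqI)
    show "f v \<in> \<Omega> \<rightarrow>\<^sub>E carrier K" "h v \<in> \<Omega> \<rightarrow>\<^sub>E carrier K"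
      using End_closed[OF f v] End_closed[OF h v] by simp_all
    fix \<gamma> assume \<gamma>: "\<gamma> \<in> \<Omega>"
    have "(\<Oplus>\<delta>\<in>\<Omega>. entry f \<gamma> \<delta> \<otimes> v \<delta>) = (\<Oplus>\<delta>\<in>\<Omega>. entry h \<gamma> \<delta> \<otimes> v \<delta>)"
      using v \<gamma> h by (intro finsum_cong') (auto simp: eq entry_closed PiE_iff)
    then show "f v \<gamma> = h v \<gamma>"
      using f h v \<gamma> by (simp add: apply_entry del: V_simps)
  qed
qed

definition invariant_matrix :: "('a \<Rightarrow> 'a \<Rightarrow> 'b) \<Rightarrow> bool"
  where "invariant_matrix a \<longleftrightarrow> (\<forall>\<gamma>\<in>\<Omega>. \<forall>\<delta>\<in>\<Omega>. a \<gamma> \<delta> \<in> carrier K) \<and>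
    (\<forall>g\<in>G. \<forall>\<gamma>\<in>\<Omega>. \<forall>\<delta>\<in>\<Omega>. a (g \<gamma>) (g \<delta>) = a \<gamma> \<delta>)"

definition endo :: "('a \<Rightarrow> 'a \<Rightarrow> 'b) \<Rightarrow> ('a \<Rightarrow> 'b) \<Rightarrow> 'a \<Rightarrow> 'b"
  where "endo a = (\<lambda>v\<in>carrier V. \<lambda>\<gamma>\<in>\<Omega>. \<Oplus>\<delta>\<in>\<Omega>. a \<gamma> \<delta> \<otimes> v \<delta>)"

lemma entry_endo:
  assumes a: "invariant_matrix a" and "\<gamma> \<in> \<Omega>" and "\<delta> \<in> \<Omega>"
  shows "entry (endo a) \<gamma> \<delta> = a \<gamma> \<delta>"
proof -
  have "entry (endo a) \<gamma> \<delta> = (\<Oplus>\<beta>\<in>\<Omega>. a \<gamma> \<beta> \<otimes> e \<delta> \<beta>)"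
    using assms by (simp add: entry_def endo_def)
  also have "\<dots> = (\<Oplus>\<beta>\<in>\<Omega>. if \<beta> = \<delta> then a \<gamma> \<beta> else \<zero>)"
    using assms by (intro finsum_cong') (auto simp: perm_basis_def invariant_matrix_def)
  also have "\<dots> = a \<gamma> \<delta>"
    using assms finite_domain by (intro finsum_delta) (auto simp: invariant_matrix_def)
  finally show ?thesis .
qed

text \<open>Linearity over \<open>KG\<close> comes down to the substitution \<open>\<delta> \<mapsto> g \<delta>\<close> in a row of the matrix, which the
invariance of the matrix turns into a change of row.\<close>

lemma endo_mem:
  assumes a: "invariant_matrix a"
  shows "endo a \<in> carrier E"
proof -
  have ac: "a \<gamma> \<delta> \<in> carrier K" if "\<gamma> \<in> \<Omega>" "\<delta> \<in> \<Omega>" for \<gamma> \<delta>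
    using a that by (simp add: invariant_matrix_def)
  have ainv: "a (g \<gamma>) (g \<delta>) = a \<gamma> \<delta>" if "g \<in> G" "\<gamma> \<in> \<Omega>" "\<delta> \<in> \<Omega>" for g \<gamma> \<delta>
    using a that by (simp add: invariant_matrix_def)
  have closed: "endo a v \<in> carrier V" if "v \<in> carrier V" for v
    using that by (auto simp: endo_def ac PiE_iff intro!: finsum_closed)
  have add: "endo a (v \<oplus>\<^bsub>V\<^esub> w) = endo a v \<oplus>\<^bsub>V\<^esub> endo a w" if v: "v \<in> carrier V" and w: "w \<in> carrier V" for v w
  proof (rule V_eqI)
    fix \<gamma> assume \<gamma>: "\<gamma> \<in> \<Omega>"
    have "(\<Oplus>\<delta>\<in>\<Omega>. a \<gamma> \<delta> \<otimes> (v \<delta> \<oplus> w \<delta>)) = (\<Oplus>\<delta>\<in>\<Omega>. a \<gamma> \<delta> \<otimes> v \<delta> \<oplus> a \<gamma> \<delta> \<otimes> w \<delta>)"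
      using v w \<gamma> by (intro finsum_cong') (auto simp: r_distr ac PiE_iff)
    also have "\<dots> = (\<Oplus>\<delta>\<in>\<Omega>. a \<gamma> \<delta> \<otimes> v \<delta>) \<oplus> (\<Oplus>\<delta>\<in>\<Omega>. a \<gamma> \<delta> \<otimes> w \<delta>)"
      using v w \<gamma> by (intro finsum_addf) (auto simp: ac PiE_iff)
    moreover have "(\<Oplus>\<delta>\<in>\<Omega>. a \<gamma> \<delta> \<otimes> (v \<oplus>\<^bsub>V\<^esub> w) \<delta>) = (\<Oplus>\<delta>\<in>\<Omega>. a \<gamma> \<delta> \<otimes> (v \<delta> \<oplus> w \<delta>))"
      using v w \<gamma> by (intro finsum_cong') (auto simp: ac PiE_iff)
    ultimately show "endo a (v \<oplus>\<^bsub>V\<^esub> w) \<gamma> = (endo a v \<oplus>\<^bsub>V\<^esub> endo a w) \<gamma>"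
      using v w \<gamma> V.a_closed[OF v w] by (simp add: endo_def)
  next
    show "endo a (v \<oplus>\<^bsub>V\<^esub> w) \<in> \<Omega> \<rightarrow>\<^sub>E carrier K" "endo a v \<oplus>\<^bsub>V\<^esub> endo a w \<in> \<Omega> \<rightarrow>\<^sub>E carrier K"
      using closed[OF V.a_closed[OF v w]] V.a_closed[OF closed[OF v] closed[OF w]] by simp_all
  qed
  have move: "(\<Oplus>\<delta>\<in>\<Omega>. a \<gamma> \<delta> \<otimes> v (inv_into \<Omega> g \<delta>)) = (\<Oplus>\<delta>\<in>\<Omega>. a (inv_into \<Omega> g \<gamma>) \<delta> \<otimes> v \<delta>)"
    if g: "g \<in> G" and v: "v \<in> carrier V" and \<gamma>: "\<gamma> \<in> \<Omega>" for g v \<gamma>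
  proof -
    have "(\<Oplus>\<delta>\<in>g ` \<Omega>. a \<gamma> \<delta> \<otimes> v (inv_into \<Omega> g \<delta>)) = (\<Oplus>\<delta>\<in>\<Omega>. a \<gamma> (g \<delta>) \<otimes> v (inv_into \<Omega> g (g \<delta>)))"
      using bij_perm[OF g] g v \<gamma> by (intro finsum_reindex) (auto simp: bij_betw_def ac PiE_iff)
    also have "\<dots> = (\<Oplus>\<delta>\<in>\<Omega>. a (inv_into \<Omega> g \<gamma>) \<delta> \<otimes> v \<delta>)"
    proof (intro finsum_cong' refl)
      fix \<delta> assume \<delta>: "\<delta> \<in> \<Omega>"
      have "a \<gamma> (g \<delta>) = a (inv_into \<Omega> g \<gamma>) \<delta>"
        using ainv[OF g, of "inv_into \<Omega> g \<gamma>" \<delta>] g \<gamma> \<delta> by simp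
      then show "a \<gamma> (g \<delta>) \<otimes> v (inv_into \<Omega> g (g \<delta>)) = a (inv_into \<Omega> g \<gamma>) \<delta> \<otimes> v \<delta>"
        using g \<delta> by simp
    qed (use g v \<gamma> in \<open>auto simp: ac PiE_iff\<close>)
    finally show ?thesis using bij_perm[OF g] by (simp add: bij_betw_def)
  qed
  have act: "endo a (group_algebra_act K \<Omega> G v r) = group_algebra_act K \<Omega> G (endo a v) r"
    if v: "v \<in> carrier V" and r: "r \<in> group_algebra_carrier K G" for v r
  proof (rule V_eqI)
    have rc: "r g \<in> carrier K" if "g \<in> G" for g using r that by (auto simp: group_algebra_carrier_def)
    have vc: "v \<delta> \<in> carrier K" if "\<delta> \<in> \<Omega>" for \<delta> using v that by auto
    fix \<gamma> assume \<gamma>: "\<gamma> \<in> \<Omega>"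
    have "endo a (group_algebra_act K \<Omega> G v r) \<gamma> =
        (\<Oplus>\<delta>\<in>\<Omega>. a \<gamma> \<delta> \<otimes> group_algebra_act K \<Omega> G v r \<delta>)"
      using v r \<gamma> group_algebra_act_closed by (simp add: endo_def)
    also have "\<dots> = (\<Oplus>\<delta>\<in>\<Omega>. \<Oplus>g\<in>G. r g \<otimes> (a \<gamma> \<delta> \<otimes> v (inv_into \<Omega> g \<delta>)))"
    proof (intro finsum_cong' refl)
      fix \<delta> assume \<delta>: "\<delta> \<in> \<Omega>"
      have "a \<gamma> \<delta> \<otimes> (\<Oplus>g\<in>G. r g \<otimes> v (inv_into \<Omega> g \<delta>)) = (\<Oplus>g\<in>G. a \<gamma> \<delta> \<otimes> (r g \<otimes> v (inv_into \<Omega> g \<delta>)))"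
        using \<gamma> \<delta> finite_perms by (intro finsum_rdistr) (auto simp: ac rc vc)
      also have "\<dots> = (\<Oplus>g\<in>G. r g \<otimes> (a \<gamma> \<delta> \<otimes> v (inv_into \<Omega> g \<delta>)))"
        using \<gamma> \<delta> by (intro finsum_cong') (auto simp: ac rc vc m_lcomm)
      finally show "a \<gamma> \<delta> \<otimes> group_algebra_act K \<Omega> G v r \<delta> = \<dots>"
        using v r \<delta> by (simp add: group_algebra_act_eq)
    qed (use \<gamma> in \<open>auto simp: ac rc vc intro!: finsum_closed\<close>)
    also have "\<dots> = (\<Oplus>g\<in>G. \<Oplus>\<delta>\<in>\<Omega>. r g \<otimes> (a \<gamma> \<delta> \<otimes> v (inv_into \<Omega> g \<delta>)))"
      using \<gamma> finite_domain finite_perms by (intro finsum_swap) (auto simp: ac rc vc)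
    also have "\<dots> = (\<Oplus>g\<in>G. r g \<otimes> endo a v (inv_into \<Omega> g \<gamma>))"
    proof (intro finsum_cong' refl)
      fix g assume g: "g \<in> G"
      have "(\<Oplus>\<delta>\<in>\<Omega>. r g \<otimes> (a \<gamma> \<delta> \<otimes> v (inv_into \<Omega> g \<delta>))) =
          r g \<otimes> (\<Oplus>\<delta>\<in>\<Omega>. a \<gamma> \<delta> \<otimes> v (inv_into \<Omega> g \<delta>))"
        using g \<gamma> finite_domain by (intro finsum_rdistr[symmetric]) (auto simp: ac rc vc)
      then show "(\<Oplus>\<delta>\<in>\<Omega>. r g \<otimes> (a \<gamma> \<delta> \<otimes> v (inv_into \<Omega> g \<delta>))) = r g \<otimes> endo a v (inv_into \<Omega> g \<gamma>)"
        using g v \<gamma> by (simp add: move endo_def)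
    qed (use \<gamma> rc V_closed[of "endo a v"] closed[OF v] in \<open>auto\<close>)
    also have "\<dots> = group_algebra_act K \<Omega> G (endo a v) r \<gamma>"
      using closed[OF v] r \<gamma> by (simp add: group_algebra_act_eq)
    finally show "endo a (group_algebra_act K \<Omega> G v r) \<gamma> = group_algebra_act K \<Omega> G (endo a v) r \<gamma>" .
  qed (use closed[OF group_algebra_act_closed[OF v r]] group_algebra_act_closed[OF closed[OF v] r] in simp_all)
  have "endo a \<in> carrier V \<rightarrow>\<^sub>E carrier V"
    using closed unfolding endo_def by (intro PiE_I) (simp_all del: V_simps)
  then show ?thesis
    unfolding End_carrier using add act by blast
qed

section \<open>The endomorphism algebra\<close>

lemma group_algebra_act_add:
  assumes v: "v \<in> carrier V" and w: "w \<in> carrier V" and r: "r \<in> group_algebra_carrier K G"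
  shows "group_algebra_act K \<Omega> G (v \<oplus>\<^bsub>V\<^esub> w) r =
    group_algebra_act K \<Omega> G v r \<oplus>\<^bsub>V\<^esub> group_algebra_act K \<Omega> G w r"
proof -
  have rc: "r g \<in> carrier K" if "g \<in> G" for g using r that by (auto simp: group_algebra_carrier_def)
  have "(\<Oplus>g\<in>G. r g \<otimes> (v \<oplus>\<^bsub>V\<^esub> w) (inv_into \<Omega> g \<beta>)) =
      (\<Oplus>g\<in>G. r g \<otimes> v (inv_into \<Omega> g \<beta>)) \<oplus> (\<Oplus>g\<in>G. r g \<otimes> w (inv_into \<Omega> g \<beta>))"
    if \<beta>: "\<beta> \<in> \<Omega>" for \<beta>
  proof -
    have "(\<Oplus>g\<in>G. r g \<otimes> (v \<oplus>\<^bsub>V\<^esub> w) (inv_into \<Omega> g \<beta>)) =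
        (\<Oplus>g\<in>G. r g \<otimes> v (inv_into \<Omega> g \<beta>) \<oplus> r g \<otimes> w (inv_into \<Omega> g \<beta>))"
      using v w \<beta> by (intro finsum_cong') (auto simp: r_distr rc PiE_iff)
    also have "\<dots> = (\<Oplus>g\<in>G. r g \<otimes> v (inv_into \<Omega> g \<beta>)) \<oplus> (\<Oplus>g\<in>G. r g \<otimes> w (inv_into \<Omega> g \<beta>))"
      using v w \<beta> by (intro finsum_addf) (auto simp: rc PiE_iff)
    finally show ?thesis .
  qed
  then show ?thesis
    using V.a_closed[OF v w] v w r by (simp add: group_algebra_act_eq cong: restrict_cong)
qed

lemma group_algebra_act_smult:
  assumes c: "c \<in> carrier K" and v: "v \<in> carrier V" and r: "r \<in> group_algebra_carrier K G"
  shows "group_algebra_act K \<Omega> G (c \<odot>\<^bsub>V\<^esub> v) r = c \<odot>\<^bsub>V\<^esub> group_algebra_act K \<Omega> G v r"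
proof -
  have rc: "r g \<in> carrier K" if "g \<in> G" for g using r that by (auto simp: group_algebra_carrier_def)
  have "(\<Oplus>g\<in>G. r g \<otimes> (c \<odot>\<^bsub>V\<^esub> v) (inv_into \<Omega> g \<beta>)) = c \<otimes> (\<Oplus>g\<in>G. r g \<otimes> v (inv_into \<Omega> g \<beta>))"
    if \<beta>: "\<beta> \<in> \<Omega>" for \<beta>
  proof -
    have "(\<Oplus>g\<in>G. r g \<otimes> (c \<odot>\<^bsub>V\<^esub> v) (inv_into \<Omega> g \<beta>)) =
        (\<Oplus>g\<in>G. c \<otimes> (r g \<otimes> v (inv_into \<Omega> g \<beta>)))"
      using c v \<beta> by (intro finsum_cong') (auto simp: m_lcomm rc PiE_iff)
    also have "\<dots> = c \<otimes> (\<Oplus>g\<in>G. r g \<otimes> v (inv_into \<Omega> g \<beta>))"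
      using c v \<beta> finite_perms by (intro finsum_rdistr[symmetric]) (auto simp: rc PiE_iff)
    finally show ?thesis .
  qed
  then show ?thesis
    using V.smult_closed[OF c v] v r by (simp add: group_algebra_act_eq cong: restrict_cong)
qed

lemma End_fun_eqI:
  assumes "f \<in> carrier E" and "h \<in> carrier E" and "\<And>v. v \<in> carrier V \<Longrightarrow> f v = h v"
  shows "f = h"
  using assms by (intro PiE_ext[of f "carrier V" _ h]) (auto simp: End_carrier simp del: V_simps)

lemma End_apply:
  assumes "v \<in> carrier V"
  shows "(f \<otimes>\<^bsub>E\<^esub> h) v = f (h v)"
    and "\<one>\<^bsub>E\<^esub> v = v"
    and "\<zero>\<^bsub>E\<^esub> v = \<zero>\<^bsub>V\<^esub>"
    and "(f \<oplus>\<^bsub>E\<^esub> h) v = f v \<oplus>\<^bsub>V\<^esub> h v"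
    and "(c \<odot>\<^bsub>E\<^esub> f) v = c \<odot>\<^bsub>V\<^esub> f v"
  using assms by (simp_all add: compose_def del: V_simps)

lemma End_act:
  "f \<in> carrier E \<Longrightarrow> v \<in> carrier V \<Longrightarrow> r \<in> group_algebra_carrier K G \<Longrightarrow>
    f (group_algebra_act K \<Omega> G v r) = group_algebra_act K \<Omega> G (f v) r"
  by (simp add: End_carrier del: V_simps)

lemma End_memI:
  assumes "f \<in> extensional (carrier V)"
    and "\<And>v. v \<in> carrier V \<Longrightarrow> f v \<in> carrier V"
    and "\<And>v w. v \<in> carrier V \<Longrightarrow> w \<in> carrier V \<Longrightarrow> f (v \<oplus>\<^bsub>V\<^esub> w) = f v \<oplus>\<^bsub>V\<^esub> f w"
    and "\<And>v r. v \<in> carrier V \<Longrightarrow> r \<in> group_algebra_carrier K G \<Longrightarrow>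
      f (group_algebra_act K \<Omega> G v r) = group_algebra_act K \<Omega> G (f v) r"
  shows "f \<in> carrier E"
  using assms unfolding End_carrier PiE_def by blast

lemma End_add_closed: "f \<in> carrier E \<Longrightarrow> h \<in> carrier E \<Longrightarrow> f \<oplus>\<^bsub>E\<^esub> h \<in> carrier E"
  by (rule End_memI)
    (simp_all add: End_closed End_add End_act group_algebra_act_add group_algebra_act_closed V.a_ac
      del: V_simps)

lemma End_smult_closed: "c \<in> carrier K \<Longrightarrow> f \<in> carrier E \<Longrightarrow> c \<odot>\<^bsub>E\<^esub> f \<in> carrier E"
  by (rule End_memI)
    (simp_all add: End_closed End_add End_act group_algebra_act_smult group_algebra_act_closed
      V.smult_r_distr del: V_simps)

lemma End_mult_closed: "f \<in> carrier E \<Longrightarrow> h \<in> carrier E \<Longrightarrow> f \<otimes>\<^bsub>E\<^esub> h \<in> carrier E"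
  by (rule End_memI)
    (simp_all add: End_closed End_add End_act group_algebra_act_closed compose_def del: V_simps)

lemma End_one_closed: "\<one>\<^bsub>E\<^esub> \<in> carrier E"
  by (rule End_memI) (simp_all add: group_algebra_act_closed del: V_simps)

lemma End_zero_closed: "\<zero>\<^bsub>E\<^esub> \<in> carrier E"
proof -
  have "\<zero>\<^bsub>E\<^esub> = \<zero> \<odot>\<^bsub>E\<^esub> \<one>\<^bsub>E\<^esub>"
    by (auto simp del: V_simps intro!: restrict_ext)
  then show ?thesis using End_smult_closed[OF zero_closed End_one_closed] by metis
qed

lemma abelian_group_End: "abelian_group E"
proof (rule abelian_groupI)
  fix f assume f: "f \<in> carrier E"
  show "\<exists>h\<in>carrier E. h \<oplus>\<^bsub>E\<^esub> f = \<zero>\<^bsub>E\<^esub>"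
  proof (rule bexI)
    have "(\<ominus> \<one>) \<odot>\<^bsub>V\<^esub> f v \<oplus>\<^bsub>V\<^esub> f v = \<zero>\<^bsub>V\<^esub>" if "v \<in> carrier V" for v
      using End_closed[OF f that] by (simp add: V.smult_l_minus V.l_neg del: V_simps)
    then show "(\<ominus> \<one>) \<odot>\<^bsub>E\<^esub> f \<oplus>\<^bsub>E\<^esub> f = \<zero>\<^bsub>E\<^esub>"
      by (auto simp del: V_simps intro!: restrict_ext)
    show "(\<ominus> \<one>) \<odot>\<^bsub>E\<^esub> f \<in> carrier E"
      using f by (intro End_smult_closed) auto
  qed
qed (auto intro!: End_add_closed End_zero_closed End_fun_eqI
    simp: End_closed End_apply V.a_ac simp del: V_simps End_simps)

lemma module_End: "module K E"
  by (rule moduleI)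
    (auto intro!: is_cring abelian_group_End End_smult_closed End_add_closed End_fun_eqI
      simp: End_closed End_apply V.smult_l_distr V.smult_r_distr V.smult_assoc1 simp del: V_simps End_simps)

lemma ring_End: "ring E"
proof (rule ringI)
  show "monoid E"
    by (rule monoidI)
      (auto intro!: End_mult_closed End_one_closed End_fun_eqI simp: End_closed End_apply simp del: V_simps End_simps)
qed (auto intro!: abelian_group_End End_mult_closed End_add_closed End_fun_eqI
      simp: End_closed End_add End_apply simp del: V_simps End_simps)

sublocale E: module K E
  by (rule module_End)

sublocale E: ring E
  by (rule ring_End)

lemma entry_add:
  "\<gamma> \<in> \<Omega> \<Longrightarrow> entry (f \<oplus>\<^bsub>E\<^esub> h) \<gamma> \<delta> = entry f \<gamma> \<delta> \<oplus> entry h \<gamma> \<delta>"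
  by (simp add: entry_def)

lemma entry_smult:
  "\<gamma> \<in> \<Omega> \<Longrightarrow> entry (c \<odot>\<^bsub>E\<^esub> f) \<gamma> \<delta> = c \<otimes> entry f \<gamma> \<delta>"
  by (simp add: entry_def)

lemma entry_mult:
  assumes "f \<in> carrier E" and "h \<in> carrier E" and "\<gamma> \<in> \<Omega>"
  shows "entry (f \<otimes>\<^bsub>E\<^esub> h) \<gamma> \<delta> = (\<Oplus>\<beta>\<in>\<Omega>. entry f \<gamma> \<beta> \<otimes> entry h \<beta> \<delta>)"
proof -
  have "h (e \<delta>) \<in> carrier V"
    using assms End_closed by simp
  then show ?thesis
    using apply_entry[of f "h (e \<delta>)" \<gamma>] assms by (simp add: entry_def compose_def)
qed

lemma entry_finsum:
  assumes "finite I" and "f \<in> I \<rightarrow> carrier E" and "\<gamma> \<in> \<Omega>" and "\<delta> \<in> \<Omega>"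
  shows "entry (\<Oplus>\<^bsub>E\<^esub>i\<in>I. f i) \<gamma> \<delta> = (\<Oplus>i\<in>I. entry (f i) \<gamma> \<delta>)"
  using assms(1,2)
proof (induction I rule: finite_induct)
  case empty
  show ?case using \<open>\<gamma> \<in> \<Omega>\<close> by (simp add: entry_def)
next
  case (insert x I)
  then have "(\<Oplus>\<^bsub>E\<^esub>i\<in>insert x I. f i) = f x \<oplus>\<^bsub>E\<^esub> (\<Oplus>\<^bsub>E\<^esub>i\<in>I. f i)"
    by (intro E.finsum_insert) auto
  moreover have "(\<Oplus>i\<in>insert x I. entry (f i) \<gamma> \<delta>) = entry (f x) \<gamma> \<delta> \<oplus> (\<Oplus>i\<in>I. entry (f i) \<gamma> \<delta>)"
    using insert \<open>\<gamma> \<in> \<Omega>\<close> \<open>\<delta> \<in> \<Omega>\<close> by (intro finsum_insert) (auto simp: entry_closed Pi_iff)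
  ultimately show ?case
    using insert \<open>\<gamma> \<in> \<Omega>\<close> by (simp add: entry_add del: End_simps)
qed

lemma End_smult_mult:
  assumes "c \<in> carrier K" and "f \<in> carrier E" and "h \<in> carrier E"
  shows "(c \<odot>\<^bsub>E\<^esub> f) \<otimes>\<^bsub>E\<^esub> h = c \<odot>\<^bsub>E\<^esub> (f \<otimes>\<^bsub>E\<^esub> h)"
    and "f \<otimes>\<^bsub>E\<^esub> (c \<odot>\<^bsub>E\<^esub> h) = c \<odot>\<^bsub>E\<^esub> (f \<otimes>\<^bsub>E\<^esub> h)"
  using assms by (auto simp: compose_def End_closed End_smult simp del: V_simps intro!: restrict_ext)

text \<open>Injectivity of \<open>b\<close> serves to index the spanning family by the set of its members.\<close>

lemma fin_dim_algebra_End: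
  assumes "finite I" and "inj_on b I" and "b \<in> I \<rightarrow> carrier E"
    and "\<And>x i. x \<in> carrier E \<Longrightarrow> i \<in> I \<Longrightarrow> \<epsilon> i x \<in> carrier K"
    and expand: "\<And>x. x \<in> carrier E \<Longrightarrow> x = (\<Oplus>\<^bsub>E\<^esub>i\<in>I. \<epsilon> i x \<odot>\<^bsub>E\<^esub> b i)"
  shows "fin_dim_algebra K E"
proof (intro fin_dim_algebra.intro fin_dim_algebra_axioms.intro)
  show "field K" "module K E" "ring E"
    by (rule field_axioms module_End ring_End)+
next
  fix c f h assume "c \<in> carrier K" "f \<in> carrier E" "h \<in> carrier E"
  then show "(c \<odot>\<^bsub>E\<^esub> f) \<otimes>\<^bsub>E\<^esub> h = c \<odot>\<^bsub>E\<^esub> (f \<otimes>\<^bsub>E\<^esub> h)"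
    and "f \<otimes>\<^bsub>E\<^esub> (c \<odot>\<^bsub>E\<^esub> h) = c \<odot>\<^bsub>E\<^esub> (f \<otimes>\<^bsub>E\<^esub> h)"
    by (rule End_smult_mult)+
next
  show "\<exists>B. finite B \<and> B \<subseteq> carrier E \<and>
      (\<forall>x\<in>carrier E. \<exists>c\<in>B \<rightarrow> carrier K. x = (\<Oplus>\<^bsub>E\<^esub>b\<in>B. c b \<odot>\<^bsub>E\<^esub> b))"
  proof (intro exI conjI ballI)
    show "finite (b ` I)" "b ` I \<subseteq> carrier E" using assms by auto
    fix x assume x: "x \<in> carrier E"
    define c where "c y = \<epsilon> (inv_into I b y) x" for y
    have c: "c (b i) = \<epsilon> i x" if "i \<in> I" for i
      using that \<open>inj_on b I\<close> by (simp add: c_def)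
    then have "c \<in> b ` I \<rightarrow> carrier K" using assms(4) x by auto
    moreover have "x = (\<Oplus>\<^bsub>E\<^esub>y\<in>b ` I. c y \<odot>\<^bsub>E\<^esub> y)"
    proof -
      have "(\<Oplus>\<^bsub>E\<^esub>y\<in>b ` I. c y \<odot>\<^bsub>E\<^esub> y) = (\<Oplus>\<^bsub>E\<^esub>i\<in>I. c (b i) \<odot>\<^bsub>E\<^esub> b i)"
        using assms x c by (intro E.finsum_reindex) (auto simp: Pi_iff simp del: End_simps)
      also have "\<dots> = (\<Oplus>\<^bsub>E\<^esub>i\<in>I. \<epsilon> i x \<odot>\<^bsub>E\<^esub> b i)"
        using assms x c by (intro E.finsum_cong') (auto simp: Pi_iff simp del: End_simps)
      finally show ?thesis using expand[OF x] by simp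
    qed
    ultimately show "\<exists>c\<in>b ` I \<rightarrow> carrier K. x = (\<Oplus>\<^bsub>E\<^esub>y\<in>b ` I. c y \<odot>\<^bsub>E\<^esub> y)" by blast
  qed
qed

end

section \<open>Counting along suborbits\<close>

lemma card_filter_eq_sum: "finite A \<Longrightarrow> card {x \<in> A. P x} = (\<Sum>x\<in>A. if P x then 1 else 0)"
  by (simp add: sum.If_cases Int_def)

lemma double_count:
  assumes "finite A" and "finite B"
  shows "(\<Sum>x\<in>A. card {y \<in> B. P x y}) = (\<Sum>y\<in>B. card {x \<in> A. P x y})"
  using assms sum.swap[of "\<lambda>x y. if P x y then 1 else 0" B A] by (simp add: card_filter_eq_sum)

lemma card_filter_product:
  assumes "finite A" and "finite B"
  shows "card {p \<in> A \<times> B. P (fst p) (snd p)} = (\<Sum>x\<in>A. card {y \<in> B. P x y})"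
proof -
  have "{p \<in> A \<times> B. P (fst p) (snd p)} = (SIGMA x:A. {y \<in> B. P x y})" by auto
  then show ?thesis using assms by simp
qed

lemma card_reindex:
  assumes "bij_betw g A A"
  shows "card {\<gamma> \<in> A. P (g \<gamma>)} = card {\<gamma> \<in> A. P \<gamma>}"
proof -
  have "g ` {\<gamma> \<in> A. P (g \<gamma>)} = {\<gamma> \<in> A. P \<gamma>}"
    using assms by (force simp: bij_betw_def)
  moreover have "inj_on g {\<gamma> \<in> A. P (g \<gamma>)}"
    using assms by (auto simp: bij_betw_def inj_on_def)
  ultimately show ?thesis using card_image by metis
qed

definition suborbit :: "('a \<Rightarrow> 'a) set \<Rightarrow> 'a \<Rightarrow> 'a \<Rightarrow> 'a set"
  where "suborbit G \<alpha> \<gamma> = {g \<gamma> | g. g \<in> G \<and> g \<alpha> = \<alpha>}"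

context permutation_representation
begin

lemma stabilizer_bij:
  assumes "\<alpha> \<in> \<Omega>" and "g \<in> G" and "g \<alpha> = \<alpha>"
  shows "bij_betw g (\<Omega> - {\<alpha>}) (\<Omega> - {\<alpha>})"
  using bij_betw_DiffI[of g \<Omega> \<Omega> "{\<alpha>}" "{\<alpha>}"] bij_perm assms by auto

lemma suborbit_subset:
  assumes "\<alpha> \<in> \<Omega>" and "\<gamma> \<in> \<Omega> - {\<alpha>}"
  shows "suborbit G \<alpha> \<gamma> \<subseteq> \<Omega> - {\<alpha>}"
  using bij_betwE[OF stabilizer_bij[OF assms(1)]] assms(2) by (auto simp: suborbit_def)

lemma suborbit_refl: "\<alpha> \<in> \<Omega> \<Longrightarrow> \<gamma> \<in> \<Omega> \<Longrightarrow> \<gamma> \<in> suborbit G \<alpha> \<gamma>"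
  unfolding suborbit_def using id_mem by (auto intro!: exI[of _ "\<lambda>\<beta>\<in>\<Omega>. \<beta>"])

lemma suborbit_trans:
  assumes "\<alpha> \<in> \<Omega>" and "\<gamma> \<in> \<Omega>" and "\<delta> \<in> suborbit G \<alpha> \<gamma>" and "\<epsilon> \<in> suborbit G \<alpha> \<delta>"
  shows "\<epsilon> \<in> suborbit G \<alpha> \<gamma>"
proof -
  obtain g h where "g \<in> G" "g \<alpha> = \<alpha>" "\<delta> = g \<gamma>" and "h \<in> G" "h \<alpha> = \<alpha>" "\<epsilon> = h \<delta>"
    using assms(3,4) by (auto simp: suborbit_def)
  then show ?thesis
    unfolding suborbit_def using comp_mem[of h g] assms(1,2)
    by (intro CollectI exI[of _ "compose \<Omega> h g"]) (simp add: compose_eq)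
qed

lemma suborbit_sym:
  assumes "\<alpha> \<in> \<Omega>" and "\<gamma> \<in> \<Omega>" and "\<delta> \<in> suborbit G \<alpha> \<gamma>"
  shows "\<gamma> \<in> suborbit G \<alpha> \<delta>"
proof -
  obtain g where g: "g \<in> G" "g \<alpha> = \<alpha>" "\<delta> = g \<gamma>"
    using assms(3) by (auto simp: suborbit_def)
  then show ?thesis
    unfolding suborbit_def using inverse_mem[OF g(1)] inv_perm(3)[OF g(1) assms(1)] assms(1,2)
    by (intro CollectI exI[of _ "\<lambda>\<beta>\<in>\<Omega>. inv_into \<Omega> g \<beta>"]) simp
qed

lemma suborbit_eq:
  assumes "\<alpha> \<in> \<Omega>" and "\<gamma> \<in> \<Omega>" and "\<delta> \<in> suborbit G \<alpha> \<gamma>"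
  shows "suborbit G \<alpha> \<delta> = suborbit G \<alpha> \<gamma>"
proof -
  have "\<delta> \<in> \<Omega>" using assms by (auto simp: suborbit_def)
  then show ?thesis
    using assms suborbit_sym suborbit_trans by (meson subset_antisym subsetI)
qed

end

text \<open>Transitivity together with equal lengths of the suborbits off \<open>\<alpha>\<close>; \<open>R\<close> selects one point in
each of them.\<close>

locale equal_suborbits = permutation_representation K \<Omega> G
  for K (structure) and \<Omega> :: "'a set" and G +
  fixes \<alpha> :: 'a and m :: nat and R :: "'a set"
  assumes point: "\<alpha> \<in> \<Omega>"
    and transitive: "\<And>\<beta>. \<beta> \<in> \<Omega> \<Longrightarrow> \<exists>g\<in>G. g \<alpha> = \<beta>"
    and card_suborbit: "\<And>\<gamma>. \<gamma> \<in> \<Omega> - {\<alpha>} \<Longrightarrow> card (suborbit G \<alpha> \<gamma>) = m"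
    and transversal_subset: "R \<subseteq> \<Omega> - {\<alpha>}"
    and transversal: "\<And>\<gamma>. \<gamma> \<in> \<Omega> - {\<alpha>} \<Longrightarrow> \<exists>!\<rho>. \<rho> \<in> R \<and> \<gamma> \<in> suborbit G \<alpha> \<rho>"
begin

abbreviation "S \<equiv> \<Omega> - {\<alpha>}"
abbreviation "H \<equiv> {g \<in> G. g \<alpha> = \<alpha>}"

declare finite_domain [simp]

lemma finite_S: "finite S"
  by simp

lemma finite_R [simp]: "finite R"
  using transversal_subset finite_S by (rule finite_subset)

lemma transversal_mem: "\<rho> \<in> R \<Longrightarrow> \<rho> \<in> \<Omega>" "\<rho> \<in> R \<Longrightarrow> \<rho> \<noteq> \<alpha>" "\<rho> \<in> R \<Longrightarrow> \<rho> \<in> S"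
  using transversal_subset by auto

lemmas suborbit_subset_S = suborbit_subset[OF point]
lemmas suborbit_self = suborbit_refl[OF point]

lemma stabilizer_bij_S: "g \<in> H \<Longrightarrow> bij_betw g S S"
  using stabilizer_bij[OF point] by simp

lemma suborbit_cover: "\<gamma> \<in> S \<Longrightarrow> \<exists>\<rho>\<in>R. \<gamma> \<in> suborbit G \<alpha> \<rho>"
  using transversal by (meson ex1_implies_ex)

lemma suborbit_unique:
  assumes "\<rho> \<in> R" and "\<rho>' \<in> R" and "\<gamma> \<in> suborbit G \<alpha> \<rho>" and "\<gamma> \<in> suborbit G \<alpha> \<rho>'"
  shows "\<rho> = \<rho>'"
proof -
  have "\<gamma> \<in> S" using assms(1,3) suborbit_subset_S transversal_mem(3) by blast
  then show ?thesis using transversal assms by metis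
qed

lemma sum_over_suborbits:
  fixes N :: "'a \<Rightarrow> nat"
  assumes N: "\<And>g \<gamma>. g \<in> H \<Longrightarrow> \<gamma> \<in> S \<Longrightarrow> N (g \<gamma>) = N \<gamma>"
  shows "(\<Sum>\<gamma>\<in>S. N \<gamma>) = m * (\<Sum>\<rho>\<in>R. N \<rho>)"
proof -
  have "S = (\<Union>\<rho>\<in>R. suborbit G \<alpha> \<rho>)"
  proof (intro subset_antisym subsetI)
    show "\<gamma> \<in> (\<Union>\<rho>\<in>R. suborbit G \<alpha> \<rho>)" if "\<gamma> \<in> S" for \<gamma>
      using suborbit_cover[OF that] by (rule UN_iff[THEN iffD2])
    show "\<gamma> \<in> S" if "\<gamma> \<in> (\<Union>\<rho>\<in>R. suborbit G \<alpha> \<rho>)" for \<gamma>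
      using that suborbit_subset_S transversal_mem(3) by (meson UN_E subsetD)
  qed
  then have "(\<Sum>\<gamma>\<in>S. N \<gamma>) = (\<Sum>\<gamma>\<in>(\<Union>\<rho>\<in>R. suborbit G \<alpha> \<rho>). N \<gamma>)" by simp
  also have "\<dots> = (\<Sum>\<rho>\<in>R. \<Sum>\<gamma>\<in>suborbit G \<alpha> \<rho>. N \<gamma>)"
  proof (rule sum.UNION_disjoint)
    show "\<forall>\<rho>\<in>R. finite (suborbit G \<alpha> \<rho>)"
      using suborbit_subset_S transversal_mem(3) finite_S finite_subset by metis
    show "\<forall>\<rho>\<in>R. \<forall>\<rho>'\<in>R. \<rho> \<noteq> \<rho>' \<longrightarrow> suborbit G \<alpha> \<rho> \<inter> suborbit G \<alpha> \<rho>' = {}"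
      using suborbit_unique by (meson disjoint_iff)
  qed simp
  also have "\<dots> = (\<Sum>\<rho>\<in>R. m * N \<rho>)"
  proof (rule sum.cong)
    fix \<rho> assume \<rho>: "\<rho> \<in> R"
    have "N \<gamma> = N \<rho>" if "\<gamma> \<in> suborbit G \<alpha> \<rho>" for \<gamma>
      using that N \<rho> transversal_mem(3) by (auto simp: suborbit_def)
    then have "(\<Sum>\<gamma>\<in>suborbit G \<alpha> \<rho>. N \<gamma>) = (\<Sum>\<gamma>\<in>suborbit G \<alpha> \<rho>. N \<rho>)"
      by (intro sum.cong) auto
    then show "(\<Sum>\<gamma>\<in>suborbit G \<alpha> \<rho>. N \<gamma>) = m * N \<rho>"
      using card_suborbit \<rho> transversal_mem(3) by simp
  qed simp
  finally show ?thesis by (simp add: sum_distrib_left)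
qed

lemma card_over_suborbits:
  assumes "\<And>g \<gamma>. g \<in> H \<Longrightarrow> \<gamma> \<in> S \<Longrightarrow> P (g \<gamma>) \<longleftrightarrow> P \<gamma>"
  shows "card {\<gamma> \<in> S. P \<gamma>} = m * card {\<rho> \<in> R. P \<rho>}"
  using sum_over_suborbits[of "\<lambda>\<gamma>. if P \<gamma> then 1 else 0"] assms
  by (simp only: card_filter_eq_sum finite_S finite_R)

lemma suborbit_length_pos: "\<rho> \<in> R \<Longrightarrow> 0 < m"
  using card_suborbit[of \<rho>] suborbit_self[of \<rho>] suborbit_subset_S[of \<rho>] transversal_mem finite_S
  by (metis card_gt_0_iff empty_iff finite_subset)

text \<open>The images of \<open>m\<close> and \<open>|R|\<close> in \<open>K\<close>, as sums of ones so that distributivity applies to them.\<close>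

definition valency where "valency = (\<Oplus>i\<in>{..<m}. \<one>)"
definition suborbit_count where "suborbit_count = (\<Oplus>\<rho>\<in>R. \<one>)"

lemma valency_closed [simp]: "valency \<in> carrier K" and suborbit_count_closed [simp]: "suborbit_count \<in> carrier K"
  by (auto simp: valency_def suborbit_count_def)

lemma finsum_over_suborbits:
  assumes closed: "\<And>\<gamma>. \<gamma> \<in> S \<Longrightarrow> F \<gamma> \<in> carrier K"
    and inv: "\<And>g \<gamma>. g \<in> H \<Longrightarrow> \<gamma> \<in> S \<Longrightarrow> F (g \<gamma>) = F \<gamma>"
  shows "(\<Oplus>\<gamma>\<in>S. F \<gamma>) = valency \<otimes> (\<Oplus>\<rho>\<in>R. F \<rho>)"
proof -
  have F_closed: "\<rho> \<in> R \<Longrightarrow> F \<rho> \<in> carrier K" for \<rho> using closed transversal_mem by auto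
  have "(\<Oplus>\<gamma>\<in>S. F \<gamma>) = (\<Oplus>p\<in>{..<m} \<times> R. F (snd p))"
  proof (rule finsum_cong_fibres)
    fix v
    have "card {p \<in> {..<m} \<times> R. F (snd p) = v} = m * card {\<rho> \<in> R. F \<rho> = v}"
      using card_filter_product[of "{..<m}" R "\<lambda>_ \<rho>. F \<rho> = v"] by simp
    then show "card {\<gamma> \<in> S. F \<gamma> = v} = card {p \<in> {..<m} \<times> R. F (snd p) = v}"
      using card_over_suborbits[of "\<lambda>\<gamma>. F \<gamma> = v"] inv by simp
  qed (use F_closed closed in auto)
  also have "\<dots> = (\<Oplus>i\<in>{..<m}. \<Oplus>\<rho>\<in>R. F \<rho>)"
    using F_closed by (subst finsum_product[of _ _ "\<lambda>_. F"]) auto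
  also have "\<dots> = (\<Oplus>i\<in>{..<m}. \<one> \<otimes> (\<Oplus>\<rho>\<in>R. F \<rho>))"
    using F_closed by (intro finsum_cong') (auto intro!: finsum_closed)
  also have "\<dots> = valency \<otimes> (\<Oplus>\<rho>\<in>R. F \<rho>)"
    unfolding valency_def using F_closed by (intro finsum_ldistr[symmetric]) (auto intro!: finsum_closed)
  finally show ?thesis .
qed

text \<open>Each side is \<open>1/m\<close> times the sum of \<open>F\<close> over \<open>S \<times> S\<close>, as far as \<open>m\<close> can be inverted. Counting how
often a given value occurs replaces this division by the cancellation of a positive integer.\<close>

lemma finsum_move_transversal:
  assumes closed: "\<And>\<beta> \<gamma>. \<beta> \<in> S \<Longrightarrow> \<gamma> \<in> S \<Longrightarrow> F \<beta> \<gamma> \<in> carrier K"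
    and inv: "\<And>g \<beta> \<gamma>. g \<in> H \<Longrightarrow> \<beta> \<in> S \<Longrightarrow> \<gamma> \<in> S \<Longrightarrow> F (g \<beta>) (g \<gamma>) = F \<beta> \<gamma>"
  shows "(\<Oplus>\<beta>\<in>R. \<Oplus>\<gamma>\<in>S. F \<beta> \<gamma>) = (\<Oplus>\<gamma>\<in>R. \<Oplus>\<beta>\<in>S. F \<beta> \<gamma>)"
proof -
  have F_closed: "F \<beta> \<gamma> \<in> carrier K" "F \<gamma> \<beta> \<in> carrier K" if "\<beta> \<in> R" "\<gamma> \<in> S" for \<beta> \<gamma>
    using closed[OF transversal_mem(3) that(2)] closed[OF that(2) transversal_mem(3)] that(1) by auto
  have "(\<Oplus>p\<in>R \<times> S. F (fst p) (snd p)) = (\<Oplus>p\<in>R \<times> S. F (snd p) (fst p))"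
  proof (rule finsum_cong_fibres)
    fix v
    have row: "card {\<gamma> \<in> S. F (g \<beta>) \<gamma> = v} = card {\<gamma> \<in> S. F \<beta> \<gamma> = v}" if "g \<in> H" "\<beta> \<in> S" for g \<beta>
      using card_reindex[OF stabilizer_bij_S[OF \<open>g \<in> H\<close>], of "\<lambda>\<gamma>. F (g \<beta>) \<gamma> = v"] inv[OF that]
      by (simp cong: conj_cong)
    have col: "card {\<gamma> \<in> S. F \<gamma> (g \<beta>) = v} = card {\<gamma> \<in> S. F \<gamma> \<beta> = v}" if "g \<in> H" "\<beta> \<in> S" for g \<beta>
      using card_reindex[OF stabilizer_bij_S[OF \<open>g \<in> H\<close>], of "\<lambda>\<gamma>. F \<gamma> (g \<beta>) = v"] inv[OF \<open>g \<in> H\<close> _ \<open>\<beta> \<in> S\<close>]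
      by (simp cong: conj_cong)
    have "m * (\<Sum>\<beta>\<in>R. card {\<gamma> \<in> S. F \<beta> \<gamma> = v}) = (\<Sum>\<beta>\<in>S. card {\<gamma> \<in> S. F \<beta> \<gamma> = v})"
      using row by (intro sum_over_suborbits[symmetric]) simp
    also have "\<dots> = (\<Sum>\<gamma>\<in>S. card {\<beta> \<in> S. F \<beta> \<gamma> = v})"
      by (intro double_count) auto
    also have "\<dots> = m * (\<Sum>\<gamma>\<in>R. card {\<beta> \<in> S. F \<beta> \<gamma> = v})"
      using col by (intro sum_over_suborbits) simp
    finally have "(\<Sum>\<beta>\<in>R. card {\<gamma> \<in> S. F \<beta> \<gamma> = v}) = (\<Sum>\<gamma>\<in>R. card {\<beta> \<in> S. F \<beta> \<gamma> = v})"
      using suborbit_length_pos by (cases "R = {}") auto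
    then show "card {p \<in> R \<times> S. F (fst p) (snd p) = v} = card {p \<in> R \<times> S. F (snd p) (fst p) = v}"
      using card_filter_product[of R S "\<lambda>\<beta> \<gamma>. F \<beta> \<gamma> = v"] card_filter_product[of R S "\<lambda>\<gamma> \<beta>. F \<beta> \<gamma> = v"]
      by simp
  qed (use F_closed in \<open>simp_all add: Pi_iff mem_Times_iff del: Diff_iff\<close>)
  then show ?thesis
    using F_closed by (simp add: finsum_product del: Diff_iff)
qed

text \<open>A value occurs off the diagonal \<open>|\<Omega>| \<cdot> m\<close> times as often as along \<open>(\<alpha>, \<rho>)\<close>, because all rows of
\<open>F\<close> contain it equally often, and likewise \<open>|\<Omega>| \<cdot> m\<close> times as often as along \<open>(\<rho>, \<alpha>)\<close>.\<close>

lemma finsum_transpose: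
  assumes closed: "\<And>\<beta> \<gamma>. \<beta> \<in> \<Omega> \<Longrightarrow> \<gamma> \<in> \<Omega> \<Longrightarrow> F \<beta> \<gamma> \<in> carrier K"
    and inv: "\<And>g \<beta> \<gamma>. g \<in> G \<Longrightarrow> \<beta> \<in> \<Omega> \<Longrightarrow> \<gamma> \<in> \<Omega> \<Longrightarrow> F (g \<beta>) (g \<gamma>) = F \<beta> \<gamma>"
  shows "(\<Oplus>\<rho>\<in>R. F \<alpha> \<rho>) = (\<Oplus>\<rho>\<in>R. F \<rho> \<alpha>)"
proof (rule finsum_cong_fibres)
  fix v :: 'b
  have row: "card {\<gamma> \<in> \<Omega>. \<gamma> \<noteq> \<beta> \<and> F' \<beta> \<gamma> = v} = m * card {\<rho> \<in> R. F' \<alpha> \<rho> = v}"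
    if \<beta>: "\<beta> \<in> \<Omega>" and inv': "\<And>g \<beta> \<gamma>. g \<in> G \<Longrightarrow> \<beta> \<in> \<Omega> \<Longrightarrow> \<gamma> \<in> \<Omega> \<Longrightarrow> F' (g \<beta>) (g \<gamma>) = F' \<beta> \<gamma>"
    for \<beta> and F' :: "'a \<Rightarrow> 'a \<Rightarrow> 'b"
  proof -
    obtain g where g: "g \<in> G" "g \<alpha> = \<beta>" using transitive \<beta> by blast
    have "card {\<gamma> \<in> \<Omega>. \<gamma> \<noteq> \<beta> \<and> F' \<beta> \<gamma> = v} = card {\<gamma> \<in> \<Omega>. g \<gamma> \<noteq> g \<alpha> \<and> F' (g \<alpha>) (g \<gamma>) = v}"
      using card_reindex[OF bij_perm[OF g(1)], of "\<lambda>\<gamma>. \<gamma> \<noteq> \<beta> \<and> F' \<beta> \<gamma> = v"] g(2) by simp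
    also have "{\<gamma> \<in> \<Omega>. g \<gamma> \<noteq> g \<alpha> \<and> F' (g \<alpha>) (g \<gamma>) = v} = {\<gamma> \<in> S. F' \<alpha> \<gamma> = v}"
      using g(1) inv' point by (auto simp: perm_eq_iff)
    also have "card \<dots> = m * card {\<rho> \<in> R. F' \<alpha> \<rho> = v}"
      using inv'[of _ \<alpha>] point by (intro card_over_suborbits) force
    finally show ?thesis .
  qed
  let ?r = "card {\<rho> \<in> R. F \<alpha> \<rho> = v}" and ?c = "card {\<rho> \<in> R. F \<rho> \<alpha> = v}"
  have "card \<Omega> * (m * ?r) = (\<Sum>\<beta>\<in>\<Omega>. card {\<gamma> \<in> \<Omega>. \<gamma> \<noteq> \<beta> \<and> F \<beta> \<gamma> = v})"
    using row[of _ F] inv by simp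
  also have "\<dots> = (\<Sum>\<gamma>\<in>\<Omega>. card {\<beta> \<in> \<Omega>. \<gamma> \<noteq> \<beta> \<and> F \<beta> \<gamma> = v})"
    using finite_domain finite_domain by (rule double_count)
  also have "\<dots> = (\<Sum>\<gamma>\<in>\<Omega>. card {\<beta> \<in> \<Omega>. \<beta> \<noteq> \<gamma> \<and> F \<beta> \<gamma> = v})"
    by (simp add: eq_commute)
  also have "\<dots> = card \<Omega> * (m * ?c)"
    using row[of _ "\<lambda>\<beta> \<gamma>. F \<gamma> \<beta>"] inv by simp
  finally have "card \<Omega> * (m * ?r) = card \<Omega> * (m * ?c)" .
  moreover have "card \<Omega> \<noteq> 0" using point by auto
  ultimately show "?r = ?c"
    using suborbit_length_pos by (cases "R = {}") auto
qed (use closed point transversal_mem in auto)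

section \<open>The symmetrizing form\<close>

lemmas [simp] = point
declare End_simps [simp del]

abbreviation diag where "diag x \<equiv> entry x \<alpha> \<alpha>"
definition suborbit_sum where "suborbit_sum x = (\<Oplus>\<rho>\<in>R. entry x \<alpha> \<rho>)"
definition pairing where "pairing x y = (\<Oplus>\<rho>\<in>R. entry x \<alpha> \<rho> \<otimes> entry y \<rho> \<alpha>)"

lemma suborbit_sum_closed: "x \<in> carrier E \<Longrightarrow> suborbit_sum x \<in> carrier K"
  unfolding suborbit_sum_def using transversal_mem by (auto simp: entry_closed intro!: finsum_closed)

lemma pairing_closed: "x \<in> carrier E \<Longrightarrow> y \<in> carrier E \<Longrightarrow> pairing x y \<in> carrier K"
  unfolding pairing_def using transversal_mem by (auto simp: entry_closed intro!: finsum_closed)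

lemmas scalar_closed = suborbit_sum_closed pairing_closed entry_closed

lemma suborbit_sum_add:
  assumes "x \<in> carrier E" and "y \<in> carrier E"
  shows "suborbit_sum (x \<oplus>\<^bsub>E\<^esub> y) = suborbit_sum x \<oplus> suborbit_sum y"
proof -
  have "suborbit_sum (x \<oplus>\<^bsub>E\<^esub> y) = (\<Oplus>\<rho>\<in>R. entry x \<alpha> \<rho> \<oplus> entry y \<alpha> \<rho>)"
    unfolding suborbit_sum_def using assms transversal_mem
    by (intro finsum_cong') (auto simp: entry_add entry_closed)
  also have "\<dots> = suborbit_sum x \<oplus> suborbit_sum y"
    unfolding suborbit_sum_def using assms transversal_mem by (intro finsum_addf) (auto simp: entry_closed)
  finally show ?thesis .
qed

lemma suborbit_sum_smult:
  assumes "c \<in> carrier K" and "x \<in> carrier E"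
  shows "suborbit_sum (c \<odot>\<^bsub>E\<^esub> x) = c \<otimes> suborbit_sum x"
proof -
  have "suborbit_sum (c \<odot>\<^bsub>E\<^esub> x) = (\<Oplus>\<rho>\<in>R. c \<otimes> entry x \<alpha> \<rho>)"
    unfolding suborbit_sum_def using assms transversal_mem
    by (intro finsum_cong') (auto simp: entry_smult entry_closed)
  also have "\<dots> = c \<otimes> suborbit_sum x"
    unfolding suborbit_sum_def using assms transversal_mem
    by (intro finsum_rdistr[symmetric]) (auto simp: entry_closed)
  finally show ?thesis .
qed

lemma pairing_sym:
  assumes "x \<in> carrier E" and "y \<in> carrier E"
  shows "pairing x y = pairing y x"
proof -
  have "pairing x y = (\<Oplus>\<rho>\<in>R. entry x \<rho> \<alpha> \<otimes> entry y \<alpha> \<rho>)"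
    unfolding pairing_def using assms
    by (intro finsum_transpose[where F = "\<lambda>\<beta> \<gamma>. entry x \<beta> \<gamma> \<otimes> entry y \<gamma> \<beta>"])
      (auto simp: entry_closed entry_invariant)
  also have "\<dots> = pairing y x"
    unfolding pairing_def using assms transversal_mem by (intro finsum_cong') (auto simp: entry_closed m_comm)
  finally show ?thesis .
qed

lemma finsum_split_point:
  assumes "\<And>\<gamma>. \<gamma> \<in> \<Omega> \<Longrightarrow> F \<gamma> \<in> carrier K"
  shows "(\<Oplus>\<gamma>\<in>\<Omega>. F \<gamma>) = F \<alpha> \<oplus> (\<Oplus>\<gamma>\<in>S. F \<gamma>)"
proof -
  have "(\<Oplus>\<gamma>\<in>insert \<alpha> S. F \<gamma>) = F \<alpha> \<oplus> (\<Oplus>\<gamma>\<in>S. F \<gamma>)"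
    using assms by (intro finsum_insert) auto
  moreover have "insert \<alpha> S = \<Omega>" using point by auto
  ultimately show ?thesis by simp
qed

text \<open>Any row is a rearrangement of row \<open>\<alpha>\<close>, where each suborbit off \<open>\<alpha>\<close> contributes \<open>m\<close> equal entries.\<close>

lemma row_sum:
  assumes y: "y \<in> carrier E" and \<gamma>: "\<gamma> \<in> \<Omega>"
  shows "(\<Oplus>\<delta>\<in>\<Omega>. entry y \<gamma> \<delta>) = diag y \<oplus> valency \<otimes> suborbit_sum y"
proof -
  obtain g where g: "g \<in> G" "g \<alpha> = \<gamma>" using transitive \<gamma> by blast
  have "(\<Oplus>\<delta>\<in>g ` \<Omega>. entry y \<gamma> \<delta>) = (\<Oplus>\<delta>\<in>\<Omega>. entry y (g \<alpha>) (g \<delta>))"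
    using bij_perm[OF g(1)] y g \<gamma> by (subst finsum_reindex) (auto simp: bij_betw_def entry_closed)
  also have "\<dots> = (\<Oplus>\<delta>\<in>\<Omega>. entry y \<alpha> \<delta>)"
    using y g(1) by (intro finsum_cong') (auto simp: entry_invariant entry_closed)
  also have "\<dots> = diag y \<oplus> (\<Oplus>\<delta>\<in>S. entry y \<alpha> \<delta>)"
    using y by (intro finsum_split_point) (simp add: entry_closed)
  also have "(\<Oplus>\<delta>\<in>S. entry y \<alpha> \<delta>) = valency \<otimes> suborbit_sum y"
    unfolding suborbit_sum_def using y entry_invariant[OF y, of _ \<alpha>]
    by (intro finsum_over_suborbits) (force simp: entry_closed)+
  finally show ?thesis using bij_perm[OF g(1)] by (simp add: bij_betw_def)
qed

lemma diag_mult: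
  assumes x: "x \<in> carrier E" and y: "y \<in> carrier E"
  shows "diag (x \<otimes>\<^bsub>E\<^esub> y) = diag x \<otimes> diag y \<oplus> valency \<otimes> pairing x y"
proof -
  have "diag (x \<otimes>\<^bsub>E\<^esub> y) = diag x \<otimes> diag y \<oplus> (\<Oplus>\<gamma>\<in>S. entry x \<alpha> \<gamma> \<otimes> entry y \<gamma> \<alpha>)"
    using x y by (simp add: entry_mult entry_closed finsum_split_point)
  also have "(\<Oplus>\<gamma>\<in>S. entry x \<alpha> \<gamma> \<otimes> entry y \<gamma> \<alpha>) = valency \<otimes> pairing x y"
    unfolding pairing_def
    using x y entry_invariant[OF x, of _ \<alpha>] entry_invariant[OF y, of _ _ \<alpha>]
    by (intro finsum_over_suborbits) (force simp: entry_closed)+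
  finally show ?thesis .
qed

text \<open>Written without subtraction. Expanding the product gives the sum of \<open>x(\<alpha>, \<gamma>) y(\<gamma>, \<delta>)\<close> over
\<open>\<delta> \<in> R\<close> and all \<open>\<gamma>\<close>. For \<open>\<gamma> \<noteq> \<alpha>\<close> the restriction to \<open>R\<close> can be moved from \<open>\<delta>\<close> to \<open>\<gamma>\<close>; then \<open>\<delta>\<close>
runs through a whole row of \<open>y\<close> except for the position \<open>\<alpha>\<close>, whose terms make up the pairing.\<close>

lemma suborbit_sum_mult:
  assumes x: "x \<in> carrier E" and y: "y \<in> carrier E"
  shows "suborbit_sum (x \<otimes>\<^bsub>E\<^esub> y) \<oplus> pairing x y = diag x \<otimes> suborbit_sum y \<oplus> suborbit_sum x \<otimes> (diag y \<oplus> valency \<otimes> suborbit_sum y)"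
proof -
  have xc: "entry x \<beta> \<gamma> \<in> carrier K" and yc: "entry y \<beta> \<gamma> \<in> carrier K" if "\<beta> \<in> \<Omega>" "\<gamma> \<in> \<Omega>" for \<beta> \<gamma>
    using that x y by (auto simp: entry_closed)
  have "suborbit_sum (x \<otimes>\<^bsub>E\<^esub> y) = (\<Oplus>\<delta>\<in>R. entry x \<alpha> \<alpha> \<otimes> entry y \<alpha> \<delta> \<oplus> (\<Oplus>\<gamma>\<in>S. entry x \<alpha> \<gamma> \<otimes> entry y \<gamma> \<delta>))"
    unfolding suborbit_sum_def using x y transversal_mem
    by (intro finsum_cong') (auto simp: entry_mult finsum_split_point entry_closed intro!: finsum_closed a_closed)
  also have "\<dots> = (\<Oplus>\<delta>\<in>R. entry x \<alpha> \<alpha> \<otimes> entry y \<alpha> \<delta>) \<oplus> (\<Oplus>\<delta>\<in>R. \<Oplus>\<gamma>\<in>S. entry x \<alpha> \<gamma> \<otimes> entry y \<gamma> \<delta>)"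
    using transversal_mem by (intro finsum_addf) (auto simp: xc yc intro!: finsum_closed)
  also have "(\<Oplus>\<delta>\<in>R. entry x \<alpha> \<alpha> \<otimes> entry y \<alpha> \<delta>) = diag x \<otimes> suborbit_sum y"
    unfolding suborbit_sum_def using transversal_mem by (intro finsum_rdistr[symmetric]) (auto simp: xc yc)
  also have "(\<Oplus>\<delta>\<in>R. \<Oplus>\<gamma>\<in>S. entry x \<alpha> \<gamma> \<otimes> entry y \<gamma> \<delta>) = (\<Oplus>\<gamma>\<in>R. \<Oplus>\<delta>\<in>S. entry x \<alpha> \<gamma> \<otimes> entry y \<gamma> \<delta>)"
    using entry_invariant[OF x, of _ \<alpha>] entry_invariant[OF y]
    by (intro finsum_move_transversal[where F = "\<lambda>\<delta> \<gamma>. entry x \<alpha> \<gamma> \<otimes> entry y \<gamma> \<delta>"])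
      (force simp: xc yc)+
  finally have "suborbit_sum (x \<otimes>\<^bsub>E\<^esub> y) \<oplus> pairing x y = diag x \<otimes> suborbit_sum y \<oplus>
      ((\<Oplus>\<gamma>\<in>R. \<Oplus>\<delta>\<in>S. entry x \<alpha> \<gamma> \<otimes> entry y \<gamma> \<delta>) \<oplus> pairing x y)" (is "_ = _ \<oplus> ?c")
    using x y transversal_mem by (simp add: scalar_closed a_assoc finsum_closed Pi_iff)
  also have "?c = (\<Oplus>\<gamma>\<in>R. (\<Oplus>\<delta>\<in>S. entry x \<alpha> \<gamma> \<otimes> entry y \<gamma> \<delta>) \<oplus> entry x \<alpha> \<gamma> \<otimes> entry y \<gamma> \<alpha>)"
    unfolding pairing_def using transversal_mem by (intro finsum_addf[symmetric]) (auto simp: xc yc intro!: finsum_closed)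
  also have "\<dots> = (\<Oplus>\<gamma>\<in>R. entry x \<alpha> \<gamma> \<otimes> (diag y \<oplus> valency \<otimes> suborbit_sum y))"
  proof (intro finsum_cong' refl)
    fix \<gamma> assume "\<gamma> \<in> R"
    then have \<gamma>: "\<gamma> \<in> \<Omega>" using transversal_mem by simp
    have "entry x \<alpha> \<gamma> \<otimes> (diag y \<oplus> valency \<otimes> suborbit_sum y) = (\<Oplus>\<delta>\<in>\<Omega>. entry x \<alpha> \<gamma> \<otimes> entry y \<gamma> \<delta>)"
      using y \<gamma> by (simp add: xc yc finsum_rdistr flip: row_sum)
    then show "(\<Oplus>\<delta>\<in>S. entry x \<alpha> \<gamma> \<otimes> entry y \<gamma> \<delta>) \<oplus> entry x \<alpha> \<gamma> \<otimes> entry y \<gamma> \<alpha> =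
        entry x \<alpha> \<gamma> \<otimes> (diag y \<oplus> valency \<otimes> suborbit_sum y)"
      using \<gamma> by (simp add: finsum_split_point xc yc a_comm finsum_closed Pi_iff)
  qed (use y transversal_mem in \<open>auto simp: xc scalar_closed\<close>)
  also have "\<dots> = suborbit_sum x \<otimes> (diag y \<oplus> valency \<otimes> suborbit_sum y)"
    unfolding suborbit_sum_def[of x] using transversal_mem y by (intro finsum_ldistr[symmetric]) (auto simp: xc scalar_closed)
  finally show ?thesis .
qed

text \<open>The choice makes \<open>s m - t = 1\<close> and \<open>s + t r \<noteq> 0\<close> hold in every characteristic.\<close>

definition s where "s = (if suborbit_count = \<zero> then \<one> else \<zero>)"
definition t where "t = s \<otimes> valency \<ominus> \<one>"
definition form where "form x = s \<otimes> diag x \<oplus> t \<otimes> suborbit_sum x"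

lemma s_closed [simp]: "s \<in> carrier K" and t_closed [simp]: "t \<in> carrier K"
  by (auto simp: s_def t_def)

lemma s_valency: "s \<otimes> valency = t \<oplus> \<one>"
  by (simp add: t_def a_minus_def a_assoc l_neg)

text \<open>The left-hand side is the value of the form at the all-ones matrix. That matrix spans the only
line on which the form could be degenerate.\<close>

lemma form_all_ones_nonzero: "s \<oplus> t \<otimes> suborbit_count \<noteq> \<zero>"
proof (cases "suborbit_count = \<zero>")
  case True
  then show ?thesis by (simp add: s_def)
next
  case False
  then have "t = \<ominus> \<one>" by (simp add: t_def s_def a_minus_def)
  then have "s \<oplus> t \<otimes> suborbit_count = \<ominus> suborbit_count" using False by (simp add: s_def l_minus)
  then show ?thesis using False by (metis minus_minus minus_zero suborbit_count_closed)
qed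

lemma form_closed: "x \<in> carrier E \<Longrightarrow> form x \<in> carrier K"
  by (simp add: form_def scalar_closed)

text \<open>The product contributes \<open>s m\<close> pairings through its diagonal entry and \<open>- t\<close> through its suborbit
sum; the normalization leaves exactly one.\<close>

lemma form_mult:
  assumes x: "x \<in> carrier E" and y: "y \<in> carrier E"
  shows "form (x \<otimes>\<^bsub>E\<^esub> y) = s \<otimes> (diag x \<otimes> diag y) \<oplus>
    t \<otimes> (diag x \<otimes> suborbit_sum y \<oplus> suborbit_sum x \<otimes> (diag y \<oplus> valency \<otimes> suborbit_sum y)) \<oplus> pairing x y"
proof -
  have xy: "x \<otimes>\<^bsub>E\<^esub> y \<in> carrier E" using x y by (rule E.m_closed)
  have "form (x \<otimes>\<^bsub>E\<^esub> y) = s \<otimes> (diag x \<otimes> diag y) \<oplus> (s \<otimes> valency) \<otimes> pairing x y \<oplus> t \<otimes> suborbit_sum (x \<otimes>\<^bsub>E\<^esub> y)"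
    using x y by (simp add: form_def diag_mult scalar_closed r_distr m_assoc)
  also have "\<dots> = s \<otimes> (diag x \<otimes> diag y) \<oplus> t \<otimes> (suborbit_sum (x \<otimes>\<^bsub>E\<^esub> y) \<oplus> pairing x y) \<oplus> pairing x y"
    using x y xy by (simp add: s_valency scalar_closed r_distr l_distr a_ac)
  finally show ?thesis using x y by (simp only: suborbit_sum_mult)
qed

lemma form_sym:
  assumes "x \<in> carrier E" and "y \<in> carrier E"
  shows "form (x \<otimes>\<^bsub>E\<^esub> y) = form (y \<otimes>\<^bsub>E\<^esub> x)"
  using assms by (simp add: form_mult pairing_sym[of y x] scalar_closed r_distr l_distr a_ac m_ac)

text \<open>The indicator function of the orbit of \<open>(\<alpha>, \<gamma>)\<close>.\<close>

definition orbital_matrix where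
  "orbital_matrix \<gamma> \<beta> \<delta> = (if \<exists>g\<in>G. g \<alpha> = \<beta> \<and> g \<gamma> = \<delta> then \<one> else \<zero>)"

lemma orbital_invariant:
  assumes h: "h \<in> G" and "\<beta> \<in> \<Omega>" and "\<delta> \<in> \<Omega>" and \<gamma>: "\<gamma> \<in> \<Omega>"
  shows "(\<exists>g\<in>G. g \<alpha> = h \<beta> \<and> g \<gamma> = h \<delta>) \<longleftrightarrow> (\<exists>g\<in>G. g \<alpha> = \<beta> \<and> g \<gamma> = \<delta>)"
proof
  assume "\<exists>g\<in>G. g \<alpha> = h \<beta> \<and> g \<gamma> = h \<delta>"
  then obtain g where g: "g \<in> G" "g \<alpha> = h \<beta>" "g \<gamma> = h \<delta>" by blast
  then show "\<exists>g\<in>G. g \<alpha> = \<beta> \<and> g \<gamma> = \<delta>"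
    using comp_mem[OF inverse_mem[OF h] g(1)] assms
    by (intro bexI[where x = "compose \<Omega> (\<lambda>\<beta>\<in>\<Omega>. inv_into \<Omega> h \<beta>) g"]) (auto simp: compose_eq)
next
  assume "\<exists>g\<in>G. g \<alpha> = \<beta> \<and> g \<gamma> = \<delta>"
  then obtain g where g: "g \<in> G" "g \<alpha> = \<beta>" "g \<gamma> = \<delta>" by blast
  then show "\<exists>g\<in>G. g \<alpha> = h \<beta> \<and> g \<gamma> = h \<delta>"
    using comp_mem[OF h g(1)] \<gamma> by (intro bexI[where x = "compose \<Omega> h g"]) (auto simp: compose_eq)
qed

lemma orbital_matrix_invariant:
  assumes "\<gamma> \<in> \<Omega>"
  shows "invariant_matrix (orbital_matrix \<gamma>)" "invariant_matrix (\<lambda>\<beta> \<delta>. orbital_matrix \<gamma> \<delta> \<beta>)"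
  using assms by (auto simp: invariant_matrix_def orbital_matrix_def orbital_invariant)

lemma orbital_matrix_point: "orbital_matrix \<gamma> \<alpha> \<delta> = (if \<delta> \<in> suborbit G \<alpha> \<gamma> then \<one> else \<zero>)"
  by (auto simp: orbital_matrix_def suborbit_def)

definition orbital where "orbital \<gamma> = endo (orbital_matrix \<gamma>)"
definition coorbital where "coorbital \<gamma> = endo (\<lambda>\<beta> \<delta>. orbital_matrix \<gamma> \<delta> \<beta>)"

lemma orbital_closed: "\<gamma> \<in> \<Omega> \<Longrightarrow> orbital \<gamma> \<in> carrier E" "\<gamma> \<in> \<Omega> \<Longrightarrow> coorbital \<gamma> \<in> carrier E"
  by (simp_all add: orbital_def coorbital_def endo_mem orbital_matrix_invariant)

lemma entry_orbital:
  assumes "\<gamma> \<in> \<Omega>" and "\<delta> \<in> \<Omega>"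
  shows "entry (orbital \<gamma>) \<alpha> \<delta> = (if \<delta> \<in> suborbit G \<alpha> \<gamma> then \<one> else \<zero>)"
    and "entry (coorbital \<gamma>) \<delta> \<alpha> = (if \<delta> \<in> suborbit G \<alpha> \<gamma> then \<one> else \<zero>)"
  using assms by (simp_all add: orbital_def coorbital_def entry_endo orbital_matrix_invariant orbital_matrix_point)

lemma transversal_suborbit: "\<rho> \<in> R \<Longrightarrow> \<gamma> \<in> R \<Longrightarrow> \<rho> \<in> suborbit G \<alpha> \<gamma> \<longleftrightarrow> \<rho> = \<gamma>"
  using suborbit_unique[of \<rho> \<gamma> \<rho>] suborbit_self transversal_mem by metis

lemma suborbit_point: "suborbit G \<alpha> \<alpha> = {\<alpha>}"
  using id_mem by (auto simp: suborbit_def intro!: exI[of _ "\<lambda>\<beta>\<in>\<Omega>. \<beta>"])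

lemma pointed_transversal_suborbit:
  assumes "i \<in> insert \<alpha> R" and "j \<in> insert \<alpha> R"
  shows "j \<in> suborbit G \<alpha> i \<longleftrightarrow> j = i"
  using assms suborbit_subset_S[of i] transversal_suborbit[of j i] transversal_mem suborbit_point by (cases "i = \<alpha>"; cases "j = \<alpha>") auto

text \<open>The transposed orbital matrix has zero diagonal and, along the pairs \<open>(\<rho>, \<alpha>)\<close>, a single entry
\<open>1\<close> at \<open>\<rho> = \<gamma>\<close>. Its suborbit sum is therefore \<open>1\<close> too, although the position of the \<open>1\<close> among the
pairs \<open>(\<alpha>, \<rho>)\<close> is in general a different one.\<close>

lemma form_mult_coorbital:
  assumes x: "x \<in> carrier E" and \<gamma>: "\<gamma> \<in> R"
  shows "form (x \<otimes>\<^bsub>E\<^esub> coorbital \<gamma>) = t \<otimes> (diag x \<oplus> suborbit_sum x \<otimes> valency) \<oplus> entry x \<alpha> \<gamma>"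
proof -
  note [simp] = transversal_mem(1)[OF \<gamma>]
  have B: "coorbital \<gamma> \<in> carrier E" by (simp add: orbital_closed)
  have \<alpha>: "\<alpha> \<notin> suborbit G \<alpha> \<gamma>"
    using suborbit_subset_S[of \<gamma>] transversal_mem[OF \<gamma>] by auto
  have "diag (coorbital \<gamma>) = \<zero>" using \<alpha> by (simp add: entry_orbital)
  moreover have "suborbit_sum (coorbital \<gamma>) = \<one>"
  proof -
    have "suborbit_sum (coorbital \<gamma>) = (\<Oplus>\<rho>\<in>R. entry (coorbital \<gamma>) \<rho> \<alpha>)"
      unfolding suborbit_sum_def using B by (intro finsum_transpose) (auto simp: entry_closed entry_invariant)
    also have "\<dots> = (\<Oplus>\<rho>\<in>R. if \<rho> = \<gamma> then \<one> else \<zero>)"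
      using \<gamma> transversal_mem by (intro finsum_cong') (auto simp: entry_orbital transversal_suborbit)
    also have "\<dots> = \<one>" using finsum_delta[of R \<gamma> "\<lambda>_. \<one>"] \<gamma> by simp
    finally show ?thesis .
  qed
  moreover have "pairing x (coorbital \<gamma>) = entry x \<alpha> \<gamma>"
  proof -
    have "pairing x (coorbital \<gamma>) = (\<Oplus>\<rho>\<in>R. if \<rho> = \<gamma> then entry x \<alpha> \<rho> else \<zero>)"
      unfolding pairing_def using x \<gamma> transversal_mem
      by (intro finsum_cong') (auto simp: entry_orbital transversal_suborbit entry_closed)
    also have "\<dots> = entry x \<alpha> \<gamma>" using x \<gamma> by (intro finsum_delta) (auto simp: entry_closed)
    finally show ?thesis .
  qed
  ultimately show ?thesis
    using x B by (simp add: form_mult scalar_closed)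
qed

lemma form_add: "x \<in> carrier E \<Longrightarrow> y \<in> carrier E \<Longrightarrow> form (x \<oplus>\<^bsub>E\<^esub> y) = form x \<oplus> form y"
  by (simp add: form_def suborbit_sum_add entry_add scalar_closed r_distr a_ac)

lemma form_smult: "c \<in> carrier K \<Longrightarrow> x \<in> carrier E \<Longrightarrow> form (c \<odot>\<^bsub>E\<^esub> x) = c \<otimes> form x"
  by (simp add: form_def suborbit_sum_smult entry_smult scalar_closed r_distr m_lcomm)

text \<open>The functionals in the image of the algebra under the map to its dual. They form a subspace.\<close>

definition represented where
  "represented \<phi> \<longleftrightarrow> (\<exists>z\<in>carrier E. \<forall>x\<in>carrier E. form (x \<otimes>\<^bsub>E\<^esub> z) = \<phi> x)"

lemma represented_add:
  assumes "represented \<phi>" and "represented \<psi>"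
  shows "represented (\<lambda>x. \<phi> x \<oplus> \<psi> x)"
proof -
  obtain z w where z: "z \<in> carrier E" "\<And>x. x \<in> carrier E \<Longrightarrow> form (x \<otimes>\<^bsub>E\<^esub> z) = \<phi> x"
    and w: "w \<in> carrier E" "\<And>x. x \<in> carrier E \<Longrightarrow> form (x \<otimes>\<^bsub>E\<^esub> w) = \<psi> x"
    using assms unfolding represented_def by blast
  show ?thesis
    unfolding represented_def using z w
    by (intro bexI[where x = "z \<oplus>\<^bsub>E\<^esub> w"]) (auto simp: E.r_distr form_add)
qed

lemma represented_smult:
  assumes "c \<in> carrier K" and "represented \<phi>"
  shows "represented (\<lambda>x. c \<otimes> \<phi> x)"
proof -
  obtain z where z: "z \<in> carrier E" "\<And>x. x \<in> carrier E \<Longrightarrow> form (x \<otimes>\<^bsub>E\<^esub> z) = \<phi> x"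
    using assms unfolding represented_def by blast
  show ?thesis
    unfolding represented_def using z assms(1)
    by (intro bexI[where x = "c \<odot>\<^bsub>E\<^esub> z"]) (auto simp: End_smult_mult form_smult)
qed

lemma represented_cong:
  assumes "represented \<phi>" and "\<And>x. x \<in> carrier E \<Longrightarrow> \<phi> x = \<psi> x"
  shows "represented \<psi>"
  using assms by (simp add: represented_def)

lemma represented_finsum:
  assumes "finite I" and "\<And>i. i \<in> I \<Longrightarrow> represented (\<phi> i)"
    and "\<And>i x. i \<in> I \<Longrightarrow> x \<in> carrier E \<Longrightarrow> \<phi> i x \<in> carrier K"
  shows "represented (\<lambda>x. \<Oplus>i\<in>I. \<phi> i x)"
  using assms
proof (induction I rule: finite_induct)
  case empty
  have "form (x \<otimes>\<^bsub>E\<^esub> \<zero>\<^bsub>E\<^esub>) = \<zero>" if "x \<in> carrier E" for x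
    using form_smult[of \<zero> "\<zero>\<^bsub>E\<^esub>"] that by (simp add: form_closed)
  then show ?case unfolding represented_def by (intro bexI[of _ "\<zero>\<^bsub>E\<^esub>"]) simp_all
next
  case (insert i I)
  have "represented (\<lambda>x. \<phi> i x \<oplus> (\<Oplus>j\<in>I. \<phi> j x))"
    using insert by (intro represented_add) auto
  then show ?case
    using insert by (elim represented_cong) (auto simp: Pi_iff)
qed

text \<open>Represented by \<open>m - b\<^sub>\<gamma>\<close>, where \<open>b\<^sub>\<gamma>\<close> is the transposed orbital matrix.\<close>

lemma represented_diff:
  assumes \<gamma>: "\<gamma> \<in> R"
  shows "represented (\<lambda>x. diag x \<ominus> entry x \<alpha> \<gamma>)"
proof -
  note [simp] = transversal_mem(1)[OF \<gamma>]
  have "represented form"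
    unfolding represented_def by (intro bexI[where x = "\<one>\<^bsub>E\<^esub>"]) auto
  then have "represented (\<lambda>x. valency \<otimes> form x)"
    by (intro represented_smult) auto
  moreover have "represented (\<lambda>x. form (x \<otimes>\<^bsub>E\<^esub> coorbital \<gamma>))"
    unfolding represented_def using orbital_closed(2)[of \<gamma>] by auto
  then have "represented (\<lambda>x. (\<ominus> \<one>) \<otimes> form (x \<otimes>\<^bsub>E\<^esub> coorbital \<gamma>))"
    by (intro represented_smult) auto
  ultimately have "represented (\<lambda>x. valency \<otimes> form x \<oplus> (\<ominus> \<one>) \<otimes> form (x \<otimes>\<^bsub>E\<^esub> coorbital \<gamma>))"
    by (rule represented_add)
  then show ?thesis
  proof (rule represented_cong)
    fix x assume x: "x \<in> carrier E"
    have c: "diag x \<in> carrier K" "suborbit_sum x \<in> carrier K" "entry x \<alpha> \<gamma> \<in> carrier K"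
      using x by (simp_all add: scalar_closed)
    have "valency \<otimes> form x = (s \<otimes> valency) \<otimes> diag x \<oplus> t \<otimes> (suborbit_sum x \<otimes> valency)"
      using c by (simp add: form_def r_distr m_ac)
    also have "\<dots> = diag x \<oplus> t \<otimes> (diag x \<oplus> suborbit_sum x \<otimes> valency)"
      using c by (simp add: s_valency l_distr r_distr a_ac)
    finally show "valency \<otimes> form x \<oplus> (\<ominus> \<one>) \<otimes> form (x \<otimes>\<^bsub>E\<^esub> coorbital \<gamma>) = diag x \<ominus> entry x \<alpha> \<gamma>"
      using c x \<gamma> by (simp add: form_mult_coorbital l_minus minus_add a_minus_def a_assoc r_neg1)
        (simp add: a_ac r_neg r_neg1 r_neg2)
  qed
qed

text \<open>Summing the differences over \<open>R\<close> gives \<open>r x\<^sub>0 - \<Sigma>x\<close>, and \<open>t\<close> times this cancels the suborbit sum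
in the form and leaves \<open>(s + t r) x\<^sub>0\<close>.\<close>

lemma represented_diag: "represented diag"
proof -
  let ?u = "inv (s \<oplus> t \<otimes> suborbit_count)"
  have unit: "s \<oplus> t \<otimes> suborbit_count \<in> Units K"
    using form_all_ones_nonzero by (simp add: field_Units)
  then have u: "?u \<in> carrier K" by (rule Units_inv_closed)
  have "represented form"
    unfolding represented_def by (intro bexI[where x = "\<one>\<^bsub>E\<^esub>"]) auto
  moreover have "represented (\<lambda>x. t \<otimes> (\<Oplus>\<gamma>\<in>R. diag x \<ominus> entry x \<alpha> \<gamma>))"
    using transversal_mem by (intro represented_smult represented_finsum represented_diff) (auto simp: entry_closed)
  ultimately have "represented (\<lambda>x. form x \<oplus> t \<otimes> (\<Oplus>\<gamma>\<in>R. diag x \<ominus> entry x \<alpha> \<gamma>))"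
    by (rule represented_add)
  then have "represented (\<lambda>x. ?u \<otimes> (form x \<oplus> t \<otimes> (\<Oplus>\<gamma>\<in>R. diag x \<ominus> entry x \<alpha> \<gamma>)))"
    using u by (intro represented_smult)
  then show ?thesis
  proof (rule represented_cong)
    fix x assume x: "x \<in> carrier E"
    have c: "diag x \<in> carrier K" "suborbit_sum x \<in> carrier K" "\<And>\<gamma>. \<gamma> \<in> R \<Longrightarrow> entry x \<alpha> \<gamma> \<in> carrier K"
      using x transversal_mem by (simp_all add: scalar_closed)
    have "(\<Oplus>\<gamma>\<in>R. diag x \<ominus> entry x \<alpha> \<gamma>) \<oplus> suborbit_sum x = (\<Oplus>\<gamma>\<in>R. (diag x \<ominus> entry x \<alpha> \<gamma>) \<oplus> entry x \<alpha> \<gamma>)"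
      unfolding suborbit_sum_def using c by (intro finsum_addf[symmetric]) auto
    also have "\<dots> = (\<Oplus>\<gamma>\<in>R. \<one> \<otimes> diag x)"
      using c by (intro finsum_cong') (auto simp: a_minus_def a_assoc l_neg)
    also have "\<dots> = suborbit_count \<otimes> diag x"
      unfolding suborbit_count_def using c by (intro finsum_ldistr[symmetric]) auto
    finally have eq: "(\<Oplus>\<gamma>\<in>R. diag x \<ominus> entry x \<alpha> \<gamma>) \<oplus> suborbit_sum x = suborbit_count \<otimes> diag x" .
    have d: "(\<Oplus>\<gamma>\<in>R. diag x \<ominus> entry x \<alpha> \<gamma>) \<in> carrier K"
      using c by (intro finsum_closed) auto
    have "form x \<oplus> t \<otimes> (\<Oplus>\<gamma>\<in>R. diag x \<ominus> entry x \<alpha> \<gamma>) =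
        s \<otimes> diag x \<oplus> t \<otimes> ((\<Oplus>\<gamma>\<in>R. diag x \<ominus> entry x \<alpha> \<gamma>) \<oplus> suborbit_sum x)"
      using c(1,2) d by (simp add: form_def r_distr a_ac)
    also have "\<dots> = (s \<oplus> t \<otimes> suborbit_count) \<otimes> diag x"
      using c(1,2) by (simp add: eq l_distr m_assoc)
    finally have "?u \<otimes> (form x \<oplus> t \<otimes> (\<Oplus>\<gamma>\<in>R. diag x \<ominus> entry x \<alpha> \<gamma>)) =
        (?u \<otimes> (s \<oplus> t \<otimes> suborbit_count)) \<otimes> diag x"
      using c(1) u by (simp add: m_assoc)
    then show "?u \<otimes> (form x \<oplus> t \<otimes> (\<Oplus>\<gamma>\<in>R. diag x \<ominus> entry x \<alpha> \<gamma>)) = diag x"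
      using c(1) unit by simp
  qed
qed

lemma represented_entry:
  assumes "i \<in> insert \<alpha> R"
  shows "represented (\<lambda>x. entry x \<alpha> i)"
proof (cases "i = \<alpha>")
  case True
  then show ?thesis using represented_diag by simp
next
  case False
  then have i: "i \<in> R" using assms by simp
  have "represented (\<lambda>x. diag x \<oplus> (\<ominus> \<one>) \<otimes> (diag x \<ominus> entry x \<alpha> i))"
    using i by (intro represented_add represented_diag represented_smult represented_diff) auto
  then show ?thesis
    using transversal_mem(1)[OF i] by (elim represented_cong)
      (simp add: entry_closed l_minus a_minus_def minus_add r_neg1 r_neg2)
qed

text \<open>Both sides are invariant, so by transitivity it suffices to compare the entries in row \<open>\<alpha>\<close>.\<close>

lemma orbital_expansion:
  assumes x: "x \<in> carrier E"
  shows "x = (\<Oplus>\<^bsub>E\<^esub>i\<in>insert \<alpha> R. entry x \<alpha> i \<odot>\<^bsub>E\<^esub> orbital i)"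
proof (rule End_eqI_entry[OF x])
  have dom: "i \<in> \<Omega>" if "i \<in> insert \<alpha> R" for i using that transversal_mem by auto
  have mem: "(\<lambda>i. entry x \<alpha> i \<odot>\<^bsub>E\<^esub> orbital i) \<in> insert \<alpha> R \<rightarrow> carrier E"
    using x dom by (auto simp: entry_closed orbital_closed)
  show sum_mem: "(\<Oplus>\<^bsub>E\<^esub>i\<in>insert \<alpha> R. entry x \<alpha> i \<odot>\<^bsub>E\<^esub> orbital i) \<in> carrier E" (is "?y \<in> _")
    using mem by (rule E.finsum_closed)
  fix \<beta> \<delta> assume \<beta>: "\<beta> \<in> \<Omega>" and \<delta>: "\<delta> \<in> \<Omega>"
  obtain g where g: "g \<in> G" "g \<alpha> = \<beta>" using transitive[OF \<beta>] by blast
  define \<epsilon> where "\<epsilon> = inv_into \<Omega> g \<delta>"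
  have \<epsilon>: "\<epsilon> \<in> \<Omega>" "g \<epsilon> = \<delta>" using g(1) \<delta> by (simp_all add: \<epsilon>_def)
  obtain j where j: "j \<in> insert \<alpha> R" "\<epsilon> \<in> suborbit G \<alpha> j"
    using suborbit_cover[of \<epsilon>] suborbit_point \<epsilon>(1) by (cases "\<epsilon> = \<alpha>") auto
  have in_sub: "\<epsilon> \<in> suborbit G \<alpha> i \<longleftrightarrow> i = j" if i: "i \<in> insert \<alpha> R" for i
  proof
    assume "\<epsilon> \<in> suborbit G \<alpha> i"
    then show "i = j"
      using i j suborbit_unique[of i j \<epsilon>] suborbit_point suborbit_subset_S transversal_mem(3)
      by (cases "i = \<alpha>"; cases "j = \<alpha>") auto
  qed (use j in simp)
  obtain h where h: "h \<in> G" "h \<alpha> = \<alpha>" "h j = \<epsilon>" using j(2) by (auto simp: suborbit_def)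
  have "entry ?y \<alpha> \<epsilon> = (\<Oplus>i\<in>insert \<alpha> R. entry (entry x \<alpha> i \<odot>\<^bsub>E\<^esub> orbital i) \<alpha> \<epsilon>)"
    using mem \<epsilon>(1) by (intro entry_finsum) simp_all
  also have "\<dots> = (\<Oplus>i\<in>insert \<alpha> R. if i = j then entry x \<alpha> i else \<zero>)"
    using x dom \<epsilon>(1) in_sub by (intro finsum_cong') (auto simp: entry_smult entry_orbital entry_closed)
  also have "\<dots> = entry x \<alpha> j"
    using x j dom by (intro finsum_delta) (auto simp: entry_closed)
  also have "\<dots> = entry x \<alpha> \<epsilon>"
    using entry_invariant[OF x h(1), of \<alpha> j] h j(1) dom by simp
  finally have "entry x \<alpha> \<epsilon> = entry ?y \<alpha> \<epsilon>" by simp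
  then show "entry x \<beta> \<delta> = entry ?y \<beta> \<delta>"
    using entry_invariant[OF x g(1), of \<alpha> \<epsilon>] entry_invariant[OF sum_mem g(1), of \<alpha> \<epsilon>] g \<epsilon> by simp
qed

lemma symmetric_algebra_End: "symmetric_algebra K E"
proof -
  have dom: "i \<in> \<Omega>" if "i \<in> insert \<alpha> R" for i using that transversal_mem by auto
  have "inj_on orbital (insert \<alpha> R)"
  proof (rule inj_onI)
    fix i j assume ij: "i \<in> insert \<alpha> R" "j \<in> insert \<alpha> R" and eq: "orbital i = orbital j"
    have "entry (orbital i) \<alpha> j = entry (orbital j) \<alpha> j" using eq by simp
    then show "i = j"
      using pointed_transversal_suborbit[OF ij] pointed_transversal_suborbit[OF ij(2,2)] dom[OF ij(1)] dom[OF ij(2)]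
      by (simp add: entry_orbital split: if_splits)
  qed
  then have "fin_dim_algebra K E"
    using orbital_expansion dom
    by (intro fin_dim_algebra_End[where I = "insert \<alpha> R" and b = orbital and \<epsilon> = "\<lambda>i x. entry x \<alpha> i"])
      (auto simp: orbital_closed entry_closed)
  moreover have "\<forall>i\<in>insert \<alpha> R. \<exists>z. z \<in> carrier E \<and> (\<forall>x\<in>carrier E. form (x \<otimes>\<^bsub>E\<^esub> z) = entry x \<alpha> i)"
    using represented_entry unfolding represented_def by blast
  then obtain d where d: "\<And>i. i \<in> insert \<alpha> R \<Longrightarrow> d i \<in> carrier E"
    "\<And>i x. i \<in> insert \<alpha> R \<Longrightarrow> x \<in> carrier E \<Longrightarrow> form (x \<otimes>\<^bsub>E\<^esub> d i) = entry x \<alpha> i"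
    using bchoice[of "insert \<alpha> R"] by metis
  ultimately show ?thesis
    using dom d orbital_expansion
    by (intro fin_dim_algebra.symmetric_algebra_of_dual_bases
        [where I = "insert \<alpha> R" and b = orbital and d = d and \<sigma> = form and \<epsilon> = "\<lambda>i x. entry x \<alpha> i"])
      (auto simp: orbital_closed entry_closed form_closed form_add form_smult form_sym)
qed

end

section \<open>Three-halves-transitive groups\<close>

theorem theorem1p1:
  fixes K :: "('k, 'm) ring_scheme" and \<Omega> :: "'a set" and G :: "('a \<Rightarrow> 'a) set"
  assumes "field K"
    and "finite \<Omega>"
    and "three_halves_transitive \<Omega> G"
  shows "symmetric_algebra K (perm_module_End K \<Omega> G)"
proof -
  have G: "subgroup G (BijGroup \<Omega>)" "transitive_action (perm_group \<Omega> G) \<Omega> (\<lambda>g. g)"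
    "\<not> regular_perm_group \<Omega> G"
    using assms(3) by (simp_all add: three_halves_transitive_def)
  interpret permutation_representation K \<Omega> G
    using assms G by (simp add: permutation_representation_def permutation_representation_axioms_def)
  \<comment> \<open>On the empty set the group would be regular.\<close>
  obtain \<alpha> where \<alpha>: "\<alpha> \<in> \<Omega>"
    using G by (auto simp: regular_perm_group_def)
  have orbits: "orbits (perm_group \<Omega> (point_stabilizer \<Omega> G \<alpha>)) (\<Omega> - {\<alpha>}) (\<lambda>g. g) =
      suborbit G \<alpha> ` (\<Omega> - {\<alpha>})"
    by (auto simp: orbits_def orbit_def stabilizer_def suborbit_def)
  have equal: "card (suborbit G \<alpha> \<gamma>) = card (suborbit G \<alpha> \<delta>)"
    if "\<gamma> \<in> \<Omega> - {\<alpha>}" "\<delta> \<in> \<Omega> - {\<alpha>}" for \<gamma> \<delta>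
  proof -
    have "\<forall>\<Delta>\<in>suborbit G \<alpha> ` (\<Omega> - {\<alpha>}). \<forall>\<Delta>'\<in>suborbit G \<alpha> ` (\<Omega> - {\<alpha>}). card \<Delta> = card \<Delta>'"
      using assms(3) \<alpha> orbits unfolding three_halves_transitive_def by metis
    then show ?thesis using that by blast
  qed
  define m where "m = card (suborbit G \<alpha> (SOME \<gamma>. \<gamma> \<in> \<Omega> - {\<alpha>}))"
  \<comment> \<open>The choice depends on the suborbit only, so equal suborbits get equal representatives.\<close>
  define rep where "rep \<gamma> = (SOME \<delta>. \<delta> \<in> suborbit G \<alpha> \<gamma>)" for \<gamma>
  define R where "R = rep ` (\<Omega> - {\<alpha>})"
  have refl: "\<gamma> \<in> suborbit G \<alpha> \<gamma>" if "\<gamma> \<in> \<Omega> - {\<alpha>}" for \<gamma>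
    using suborbit_refl[OF \<alpha>] that by simp
  have same: "suborbit G \<alpha> \<delta> = suborbit G \<alpha> \<gamma>"
    if "\<gamma> \<in> \<Omega> - {\<alpha>}" "\<delta> \<in> suborbit G \<alpha> \<gamma>" for \<gamma> \<delta>
    using that by (intro suborbit_eq[OF \<alpha>]) simp_all
  have rep: "rep \<gamma> \<in> suborbit G \<alpha> \<gamma>" if "\<gamma> \<in> \<Omega> - {\<alpha>}" for \<gamma>
    unfolding rep_def using refl[OF that] by (rule someI)
  have suborbit_rep: "suborbit G \<alpha> (rep \<gamma>) = suborbit G \<alpha> \<gamma>" if "\<gamma> \<in> \<Omega> - {\<alpha>}" for \<gamma>
    using that rep[OF that] by (rule same)
  have rep_mem: "rep \<gamma> \<in> \<Omega> - {\<alpha>}" if "\<gamma> \<in> \<Omega> - {\<alpha>}" for \<gamma>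
    using suborbit_subset[OF \<alpha> that] rep[OF that] by (rule subsetD)
  have "equal_suborbits K \<Omega> G \<alpha> m R"
  proof
    show "\<alpha> \<in> \<Omega>" by (rule \<alpha>)
    show "\<exists>g\<in>G. g \<alpha> = \<beta>" if "\<beta> \<in> \<Omega>" for \<beta>
      using transitive_action.unique_orbit[OF G(2) \<alpha> that] by simp
    show "card (suborbit G \<alpha> \<gamma>) = m" if "\<gamma> \<in> \<Omega> - {\<alpha>}" for \<gamma>
      unfolding m_def using equal[OF that] someI[of "\<lambda>\<gamma>. \<gamma> \<in> \<Omega> - {\<alpha>}", OF that] by simp
    show "R \<subseteq> \<Omega> - {\<alpha>}"
      unfolding R_def using rep_mem by (rule image_subsetI)
    show "\<exists>!\<rho>. \<rho> \<in> R \<and> \<gamma> \<in> suborbit G \<alpha> \<rho>" if \<gamma>: "\<gamma> \<in> \<Omega> - {\<alpha>}" for \<gamma>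
    proof (rule ex1I)
      show "rep \<gamma> \<in> R \<and> \<gamma> \<in> suborbit G \<alpha> (rep \<gamma>)"
        unfolding R_def suborbit_rep[OF \<gamma>] using refl[OF \<gamma>] \<gamma> by (intro conjI imageI)
      fix \<rho> assume \<rho>: "\<rho> \<in> R \<and> \<gamma> \<in> suborbit G \<alpha> \<rho>"
      then obtain \<delta> where \<delta>: "\<delta> \<in> \<Omega> - {\<alpha>}" "\<rho> = rep \<delta>"
        unfolding R_def by (elim conjE imageE)
      then have "suborbit G \<alpha> \<gamma> = suborbit G \<alpha> \<delta>"
        using \<rho> suborbit_rep[OF \<delta>(1)] by (intro same) simp_all
      then show "\<rho> = rep \<gamma>" using \<delta>(2) by (simp add: rep_def)
    qed
  qed
  then show ?thesis by (rule equal_suborbits.symmetric_algebra_End)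
qed

end
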